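(* It is undecidable whether a given one-clock universal alternating timed automaton $\mathcal{A}$ with a weak parity acceptance condition of index $(1,2)$ accepts some non-Zeno timed word, even when the only clock constraints used by $\mathcal{A}$ are $x\le 1$ and $x>1$ (in particular, $\mathcal{A}$ uses no equality tests). The same holds with "some non-Zeno timed word" replaced by "some timed word".
   Context: A one-clock alternating timed automaton (ATA) $\langle Q,\Sigma,q_0,\delta,\Omega\rangle$ has finite state set $Q$, $\Omega:Q\to\mathbb{N}$ and transition function $\delta:Q\times\Sigma\times\Phi\rightharpoonup\mathcal{B}^+(Q\times\{\mathrm{nop},\mathrm{reset}\})$ (positive boolean formulas over atoms $\top,\bot,(q,f)$), $\Phi$ being clock constraints on the single clock $x$, satisfying the partition condition (for each $q,a,v$ at most one $\theta$ with $\delta(q,a,\theta)$ defined and $v\models\theta$). It is universal if all formulas in the range of $\delta$ use no disjunction. Acceptance of a timed word $(a_1,t_1)(a_2,t_2)\dots$ (with $t_i$ strictly increasing; non-Zeno means unbounded) is via the standard game: from $(q_k,v_k)$ the clock becomes $v'=v_k+t_{k+1}-t_k$, the unique enabled formula $\delta(q_k,a_{k+1},\theta)$ is resolved (Adam chooses conjuncts, Eve disjuncts; atom $(q,f)$ leads to $(q,f(v'))$ with reset meaning clock $0$; $\top$ wins for Eve, $\bot$ and absence of an enabled transition lose for Eve); an infinite play is won by Eve iff its state sequence satisfies the acceptance condition; $\mathcal{A}$ accepts iff Eve has a winning strategy. Weak parity condition: $\min\{\Omega(q_i)\}$ over all visited states is even; index $(1,2)$ means ranks in $\{1,2\}$.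 *)

theory Defs
  imports Complex_Main "HOL-Library.Nat_Bijection"
begin

datatype recf = Z | S | Id nat | Cn recf "recf list" | Pr recf recf | Mn recf

inductive eval_rf :: "recf \<Rightarrow> nat list \<Rightarrow> nat \<Rightarrow> bool" where
  ev_Z: "eval_rf Z xs 0"
| ev_S: "eval_rf S [x] (Suc x)"
| ev_Id: "i < length xs \<Longrightarrow> eval_rf (Id i) xs (xs ! i)"
| ev_Cn: "list_all2 (\<lambda>g y. eval_rf g xs y) gs ys \<Longrightarrow> eval_rf f ys z
           \<Longrightarrow> eval_rf (Cn f gs) xs z"
| ev_Pr0: "eval_rf f xs z \<Longrightarrow> eval_rf (Pr f g) (0 # xs) z"
| ev_PrS: "eval_rf (Pr f g) (n # xs) r \<Longrightarrow> eval_rf g (n # r # xs) z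
           \<Longrightarrow> eval_rf (Pr f g) (Suc n # xs) z"
| ev_Mn: "eval_rf f (n # xs) 0 \<Longrightarrow> (\<forall>m<n. \<exists>y. eval_rf f (m # xs) y \<and> y \<noteq> 0)
           \<Longrightarrow> eval_rf (Mn f) xs n"

definition decidable_on :: "('a \<Rightarrow> nat) \<Rightarrow> ('a \<Rightarrow> bool) \<Rightarrow> ('a \<Rightarrow> bool) \<Rightarrow> bool" where
  "decidable_on enc C P \<longleftrightarrow>
     (\<exists>r. \<forall>a. C a \<longrightarrow> eval_rf r [enc a] (if P a then 1 else 0))"

datatype cmp = CmpLt | CmpLe | CmpEq | CmpGe | CmpGt

datatype cc = CTrue | CAtom cmp nat | CAnd cc cc

fun sat_cc :: "cc \<Rightarrow> real \<Rightarrow> bool" where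
  "sat_cc CTrue v = True"
| "sat_cc (CAtom CmpLt c) v = (v < real c)"
| "sat_cc (CAtom CmpLe c) v = (v \<le> real c)"
| "sat_cc (CAtom CmpEq c) v = (v = real c)"
| "sat_cc (CAtom CmpGe c) v = (v \<ge> real c)"
| "sat_cc (CAtom CmpGt c) v = (v > real c)"
| "sat_cc (CAnd a b) v = (sat_cc a v \<and> sat_cc b v)"

datatype clkop = Nop | Reset

datatype bform = BTrue | BFalse | BAtom nat clkop | BAnd bform bform | BOr bform bform

fun atoms_bf :: "bform \<Rightarrow> nat set" where
  "atoms_bf BTrue = {}"
| "atoms_bf BFalse = {}"
| "atoms_bf (BAtom q f) = {q}"
| "atoms_bf (BAnd a b) = atoms_bf a \<union> atoms_bf b"
| "atoms_bf (BOr a b) = atoms_bf a \<union> atoms_bf b"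

fun has_or :: "bform \<Rightarrow> bool" where
  "has_or (BOr a b) = True"
| "has_or (BAnd a b) = (has_or a \<or> has_or b)"
| "has_or _ = False"

text \<open>States are 0..<nstates, letters are 0..<nletters; the partial transition
  function is given by a finite list of entries (q, a, theta, delta(q,a,theta));
  omega ! q is the rank of q.\<close>
record ata =
  nstates :: nat
  nletters :: nat
  init :: nat
  delta :: "(nat \<times> nat \<times> cc \<times> bform) list"
  omega :: "nat list"

definition wf_ata :: "ata \<Rightarrow> bool" where
  "wf_ata A \<longleftrightarrow>
     init A < nstates A \<and> length (omega A) = nstates A \<and>
     (\<forall>(q, a, \<theta>, \<phi>) \<in> set (delta A).
        q < nstates A \<and> a < nletters A \<and> atoms_bf \<phi> \<subseteq> {..<nstates A}) \<and>
     \<comment> \<open>delta is a (partial) function satisfying the partition condition\<close>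
     (\<forall>(q, a, \<theta>, \<phi>) \<in> set (delta A). \<forall>(q', a', \<theta>', \<phi>') \<in> set (delta A).
        q = q' \<and> a = a' \<and> (\<exists>v\<ge>0. sat_cc \<theta> v \<and> sat_cc \<theta>' v)
        \<longrightarrow> (\<theta>, \<phi>) = (\<theta>', \<phi>'))"

definition universal_ata :: "ata \<Rightarrow> bool" where
  "universal_ata A \<longleftrightarrow> (\<forall>(q, a, \<theta>, \<phi>) \<in> set (delta A). \<not> has_or \<phi>)"

definition weak_index_1_2 :: "ata \<Rightarrow> bool" where
  "weak_index_1_2 A \<longleftrightarrow> set (omega A) \<subseteq> {1, 2}"

definition uses_only_le1_gt1 :: "ata \<Rightarrow> bool" where
  "uses_only_le1_gt1 A \<longleftrightarrow>
     (\<forall>(q, a, \<theta>, \<phi>) \<in> set (delta A). \<theta> \<in> {CAtom CmpLe 1, CAtom CmpGt 1})"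

definition rank :: "ata \<Rightarrow> nat \<Rightarrow> nat" where
  "rank A q = omega A ! q"

text \<open>A timed word (a_1,t_1)(a_2,t_2)... is w :: nat => nat * real with
  w i = (a_(i+1), t_(i+1)); t_0 = 0.\<close>
definition tstamp :: "(nat \<Rightarrow> nat \<times> real) \<Rightarrow> nat \<Rightarrow> real" where
  "tstamp w k = (if k = 0 then 0 else snd (w (k - 1)))"

definition timed_word :: "ata \<Rightarrow> (nat \<Rightarrow> nat \<times> real) \<Rightarrow> bool" where
  "timed_word A w \<longleftrightarrow> (\<forall>i. fst (w i) < nletters A) \<and> 0 \<le> snd (w 0) \<and>
     (\<forall>i. snd (w i) < snd (w (Suc i)))"

definition non_zeno :: "(nat \<Rightarrow> nat \<times> real) \<Rightarrow> bool" where
  "non_zeno w \<longleftrightarrow> (\<forall>T. \<exists>i. T < snd (w i))"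

text \<open>Positions: Conf k q v (configuration (q,v) after reading k letters),
  Frm k v' phi (resolving formula phi with updated clock value v'),
  and absorbing sinks for the wins/losses of finite plays.\<close>
datatype pos = Conf nat nat real | Frm nat real bform | WinSink | LoseSink

inductive edge :: "ata \<Rightarrow> (nat \<Rightarrow> nat \<times> real) \<Rightarrow> pos \<Rightarrow> pos \<Rightarrow> bool"
  for A w where
  e_trans: "v' = v + tstamp w (Suc k) - tstamp w k \<Longrightarrow>
            (q, fst (w k), \<theta>, \<phi>) \<in> set (delta A) \<Longrightarrow> sat_cc \<theta> v' \<Longrightarrow>
            edge A w (Conf k q v) (Frm k v' \<phi>)"
| e_none: "v' = v + tstamp w (Suc k) - tstamp w k \<Longrightarrow>
            \<not> (\<exists>\<theta> \<phi>. (q, fst (w k), \<theta>, \<phi>) \<in> set (delta A) \<and> sat_cc \<theta> v') \<Longrightarrow>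
            edge A w (Conf k q v) LoseSink"
| e_and1: "edge A w (Frm k v (BAnd a b)) (Frm k v a)"
| e_and2: "edge A w (Frm k v (BAnd a b)) (Frm k v b)"
| e_or1: "edge A w (Frm k v (BOr a b)) (Frm k v a)"
| e_or2: "edge A w (Frm k v (BOr a b)) (Frm k v b)"
| e_true: "edge A w (Frm k v BTrue) WinSink"
| e_false: "edge A w (Frm k v BFalse) LoseSink"
| e_atom: "edge A w (Frm k v (BAtom q f)) (Conf (Suc k) q (if f = Reset then 0 else v))"
| e_win: "edge A w WinSink WinSink"
| e_lose: "edge A w LoseSink LoseSink"

fun eve_pos :: "pos \<Rightarrow> bool" where
  "eve_pos (Frm k v (BOr a b)) = True"
| "eve_pos _ = False"

definition eve_strategy :: "ata \<Rightarrow> (nat \<Rightarrow> nat \<times> real) \<Rightarrow> (pos list \<Rightarrow> pos) \<Rightarrow> bool" where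
  "eve_strategy A w \<sigma> \<longleftrightarrow>
     (\<forall>h. h \<noteq> [] \<and> eve_pos (last h) \<longrightarrow> edge A w (last h) (\<sigma> h))"

definition play_consistent ::
  "ata \<Rightarrow> (nat \<Rightarrow> nat \<times> real) \<Rightarrow> (pos list \<Rightarrow> pos) \<Rightarrow> (nat \<Rightarrow> pos) \<Rightarrow> bool" where
  "play_consistent A w \<sigma> p \<longleftrightarrow>
     p 0 = Conf 0 (init A) 0 \<and>
     (\<forall>n. edge A w (p n) (p (Suc n))) \<and>
     (\<forall>n. eve_pos (p n) \<longrightarrow> p (Suc n) = \<sigma> (map p [0..<Suc n]))"

definition eve_wins_play :: "ata \<Rightarrow> (nat \<Rightarrow> pos) \<Rightarrow> bool" where
  "eve_wins_play A p \<longleftrightarrow>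
     (\<exists>n. p n = WinSink) \<or>
     ((\<forall>n. p n \<noteq> LoseSink) \<and>
      even (LEAST r. \<exists>n k q v. p n = Conf k q v \<and> r = rank A q))"

definition accepts :: "ata \<Rightarrow> (nat \<Rightarrow> nat \<times> real) \<Rightarrow> bool" where
  "accepts A w \<longleftrightarrow>
     (\<exists>\<sigma>. eve_strategy A w \<sigma> \<and> (\<forall>p. play_consistent A w \<sigma> p \<longrightarrow> eve_wins_play A p))"

fun enc_cmp :: "cmp \<Rightarrow> nat" where
  "enc_cmp CmpLt = 0" | "enc_cmp CmpLe = 1" | "enc_cmp CmpEq = 2"
| "enc_cmp CmpGe = 3" | "enc_cmp CmpGt = 4"

fun enc_cc :: "cc \<Rightarrow> nat" where
  "enc_cc CTrue = prod_encode (0, 0)"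
| "enc_cc (CAtom r c) = prod_encode (1, prod_encode (enc_cmp r, c))"
| "enc_cc (CAnd a b) = prod_encode (2, prod_encode (enc_cc a, enc_cc b))"

fun enc_bf :: "bform \<Rightarrow> nat" where
  "enc_bf BTrue = prod_encode (0, 0)"
| "enc_bf BFalse = prod_encode (1, 0)"
| "enc_bf (BAtom q f) = prod_encode (2, prod_encode (q, if f = Reset then 1 else 0))"
| "enc_bf (BAnd a b) = prod_encode (3, prod_encode (enc_bf a, enc_bf b))"
| "enc_bf (BOr a b) = prod_encode (4, prod_encode (enc_bf a, enc_bf b))"

definition enc_trans :: "nat \<times> nat \<times> cc \<times> bform \<Rightarrow> nat" where
  "enc_trans e = (case e of (q, a, \<theta>, \<phi>) \<Rightarrow> list_encode [q, a, enc_cc \<theta>, enc_bf \<phi>])"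

definition enc_ata :: "ata \<Rightarrow> nat" where
  "enc_ata A = list_encode [nstates A, nletters A, init A,
      list_encode (map enc_trans (delta A)), list_encode (omega A)]"

definition input_class :: "ata \<Rightarrow> bool" where
  "input_class A \<longleftrightarrow> wf_ata A \<and> universal_ata A \<and> weak_index_1_2 A \<and> uses_only_le1_gt1 A"

end

theory Submission
  imports Defs "HOL-Library.Multiset"
begin

text \<open>
  Universality restricts the automaton to checks of the form: the first event more than one time
  unit after an item is a prescribed letter. They simulate a machine whose configurations are the blocks of
  the word, up to insertion errors: a block may contain additional items. Such errors are neutralised as follows.
  The items form a fixed budget for a counter machine. A phase simulates the machine from its
  initial configuration until the pool of unused items is exhausted, and then one item dies. An epoch is a sequence
  of phases that ends when all items are dead; then all of them are revived and one item is added. Every insertion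
  makes up for at most the one death of its phase. Hence if the machine halts, then every phase with a large budget must
  contain an error, its budget never shrinks, and the epoch cannot end. Requiring infinitely many epochs thus
  makes the automaton accept some word if and only if the machine does not halt, and the word is then non-Zeno.

  Undecidability follows by diagonalisation: a decision procedure, composed with the recursive function that maps the code
  of a program to the automaton that simulates the program on its own code, would itself be such a program.
\<close>

section \<open>Computable functions on encodings\<close>

text \<open>A copy can prescribe an event of the next block, but no branch can check that a given
  event was prescribed by some item; hence the insertions. Increments and zero branches each take
  one item from the pool. Charging zero branches makes every honest phase finite. Conversely,
  \<open>H\<close> steps take at most \<open>H\<close> items, so with \<open>H + 1\<close> live
  items the pool cannot run empty before the halting instruction blocks the run.

  Without equality tests an image lies strictly more than one unit after its item, so every block is
  delayed a little. The distance of an item to its predecessor must absorb this delay in every later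
  block. Delays \<open>1/(k+2) - 1/(k+3)\<close> decrease in \<open>k\<close>, and the distances
  have the same shape in the number of items further to the right, which never exceeds
  \<open>k\<close>.

  Consecutive control letters are more than one unit apart. If the program halts, no timed word at
  all is accepted; otherwise a non-Zeno one is. Thus one construction settles both claims.\<close>

definition computable :: "nat \<Rightarrow> (nat list \<Rightarrow> nat) \<Rightarrow> bool" where
  "computable n f \<longleftrightarrow> (\<exists>r. \<forall>xs. length xs = n \<longrightarrow> eval_rf r xs (f xs))"

definition computable_pred :: "nat \<Rightarrow> (nat list \<Rightarrow> bool) \<Rightarrow> bool" where
  "computable_pred n c \<longleftrightarrow> computable n (\<lambda>xs. if c xs then 1 else 0)"

lemma computable_cong: "(\<And>xs. length xs = n \<Longrightarrow> f xs = g xs) \<Longrightarrow> computable n g \<Longrightarrow> computable n f"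
  unfolding computable_def by metis

lemma computable_zero: "computable n (\<lambda>xs. 0)"
  unfolding computable_def using ev_Z by blast

lemma computable_nth: "i < n \<Longrightarrow> computable n (\<lambda>xs. xs ! i)"
  unfolding computable_def using ev_Id by blast

lemma computable_compose:
  assumes "\<And>g. g \<in> set gs \<Longrightarrow> computable n g" "computable (length gs) f"
  shows "computable n (\<lambda>xs. f (map (\<lambda>g. g xs) gs))"
proof -
  obtain R where R: "\<And>g xs. g \<in> set gs \<Longrightarrow> length xs = n \<Longrightarrow> eval_rf (R g) xs (g xs)"
    using assms(1) unfolding computable_def by metis
  obtain r where r: "\<And>xs. length xs = length gs \<Longrightarrow> eval_rf r xs (f xs)"
    using assms(2) unfolding computable_def by metis
  have "eval_rf (Cn r (map R gs)) xs (f (map (\<lambda>g. g xs) gs))" if "length xs = n" for xs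
  proof (rule ev_Cn)
    show "list_all2 (\<lambda>g y. eval_rf g xs y) (map R gs) (map (\<lambda>g. g xs) gs)"
      using R that by (auto simp: list_all2_conv_all_nth)
    show "eval_rf r (map (\<lambda>g. g xs) gs) (f (map (\<lambda>g. g xs) gs))"
      by (rule r) simp
  qed
  then show ?thesis unfolding computable_def by blast
qed

lemma computable_app1: "computable (Suc 0) (\<lambda>xs. F (xs ! 0)) \<Longrightarrow> computable n f \<Longrightarrow> computable n (\<lambda>xs. F (f xs))"
  using computable_compose[of "[f]" n "\<lambda>xs. F (xs ! 0)"] by simp

lemma computable_app2:
  "computable 2 (\<lambda>xs. F (xs ! 0) (xs ! 1)) \<Longrightarrow> computable n f \<Longrightarrow> computable n g \<Longrightarrow> computable n (\<lambda>xs. F (f xs) (g xs))"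
  using computable_compose[of "[f, g]" n "\<lambda>xs. F (xs ! 0) (xs ! 1)"] by (auto simp: numeral_2_eq_2)

lemma computable_Suc: "computable n f \<Longrightarrow> computable n (\<lambda>xs. Suc (f xs))"
proof (rule computable_app1[of Suc])
  have "eval_rf S xs (Suc (xs ! 0))" if "length xs = Suc 0" for xs
    using that by (cases xs) (auto intro: ev_S)
  then show "computable (Suc 0) (\<lambda>xs. Suc (xs ! 0))" unfolding computable_def by blast
qed

lemma computable_const: "computable n (\<lambda>xs. c)"
  by (induction c) (auto intro!: computable_zero computable_Suc)

text \<open>The two-argument form of \<open>Pr\<close>, with the recursion variable first. The
  recursions below are brought to this shape, if necessary by swapping arguments or adding a dummy
  parameter.\<close>

lemma computable_rec:
  assumes "computable (Suc 0) (\<lambda>xs. a (xs ! 0))" "computable 3 (\<lambda>xs. g (xs ! 0) (xs ! 1) (xs ! 2))"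
    and F: "\<And>y. F 0 y = a y" "\<And>m y. F (Suc m) y = g m (F m y) y"
  shows "computable 2 (\<lambda>xs. F (xs ! 0) (xs ! 1))"
proof -
  obtain r where r: "\<And>xs. length xs = Suc 0 \<Longrightarrow> eval_rf r xs (a (xs ! 0))"
    using assms(1) unfolding computable_def by metis
  obtain s where s: "\<And>xs. length xs = 3 \<Longrightarrow> eval_rf s xs (g (xs ! 0) (xs ! 1) (xs ! 2))"
    using assms(2) unfolding computable_def by metis
  have "eval_rf (Pr r s) [m, y] (F m y)" for m y
  proof (induction m)
    case 0
    then show ?case using r[of "[y]"] by (auto simp: F intro: ev_Pr0)
  next
    case (Suc m)
    then show ?case using s[of "[m, F m y, y]"] by (auto simp: F intro: ev_PrS)
  qed
  moreover have "xs = [xs ! 0, xs ! 1]" if "length xs = 2" for xs :: "nat list"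
    using that by (auto simp: numeral_2_eq_2 length_Suc_conv)
  ultimately have "length xs = 2 \<Longrightarrow> eval_rf (Pr r s) xs (F (xs ! 0) (xs ! 1))" for xs
    by metis
  then show ?thesis unfolding computable_def by blast
qed

lemma computable_add: "computable n f \<Longrightarrow> computable n g \<Longrightarrow> computable n (\<lambda>xs. f xs + g xs)"
  by (rule computable_app2[of "(+)"], rule computable_rec[of "\<lambda>y. y" "\<lambda>m r y. Suc r"])
    (auto intro!: computable_Suc computable_nth)

lemma computable_mult: "computable n f \<Longrightarrow> computable n g \<Longrightarrow> computable n (\<lambda>xs. f xs * g xs)"
  by (rule computable_app2[of "(*)"], rule computable_rec[of "\<lambda>y. 0" "\<lambda>m r y. y + r"])
    (auto intro!: computable_zero computable_nth computable_add)

lemma computable_pred: "computable n f \<Longrightarrow> computable n (\<lambda>xs. f xs - 1)"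
  by (rule computable_app2[of "\<lambda>x y. x - 1" n f "\<lambda>_. 0"], rule computable_rec[of "\<lambda>y. 0" "\<lambda>m r y. m"])
    (auto intro!: computable_zero computable_nth)

lemma computable_diff: "computable n f \<Longrightarrow> computable n g \<Longrightarrow> computable n (\<lambda>xs. f xs - g xs)"
  by (rule computable_app2[of "\<lambda>y x. x - y" n g f], rule computable_rec[of "\<lambda>y. y" "\<lambda>m r y. r - 1"])
    (auto intro!: computable_nth computable_pred[simplified])

lemma computable_if:
  assumes "computable_pred n c" "computable n f" "computable n g"
  shows "computable n (\<lambda>xs. if c xs then f xs else g xs)"
proof (rule computable_cong)
  show "computable n (\<lambda>xs. (if c xs then 1 else 0) * f xs + (1 - (if c xs then 1 else 0)) * g xs)"
    using assms unfolding computable_pred_def by (intro computable_add computable_mult computable_diff computable_const)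
qed auto

lemma computable_pred_eq: "computable n f \<Longrightarrow> computable n g \<Longrightarrow> computable_pred n (\<lambda>xs. f xs = g xs)"
  unfolding computable_pred_def
  by (rule computable_cong[of _ _ "\<lambda>xs. 1 - ((f xs - g xs) + (g xs - f xs))"])
    (auto intro!: computable_diff computable_add computable_const simp del: diff_Suc_1 One_nat_def)

lemma computable_pred_less: "computable n f \<Longrightarrow> computable n g \<Longrightarrow> computable_pred n (\<lambda>xs. f xs < g xs)"
  unfolding computable_pred_def
  by (rule computable_cong[of _ _ "\<lambda>xs. 1 - (1 - (g xs - f xs))"])
    (auto intro!: computable_diff computable_add computable_const simp del: One_nat_def)

lemma computable_pred_not: "computable_pred n c \<Longrightarrow> computable_pred n (\<lambda>xs. \<not> c xs)"
  unfolding computable_pred_def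
  by (rule computable_cong[of _ _ "\<lambda>xs. 1 - (if c xs then 1 else 0)"])
    (auto intro!: computable_diff computable_const simp del: One_nat_def)

lemma computable_pred_conj: "computable_pred n c \<Longrightarrow> computable_pred n d \<Longrightarrow> computable_pred n (\<lambda>xs. c xs \<and> d xs)"
  unfolding computable_pred_def
  by (rule computable_cong[of _ _ "\<lambda>xs. (if c xs then 1 else 0) * (if d xs then 1 else 0)"])
    (auto intro!: computable_mult simp del: One_nat_def)

lemma computable_pred_disj: "computable_pred n c \<Longrightarrow> computable_pred n d \<Longrightarrow> computable_pred n (\<lambda>xs. c xs \<or> d xs)"
  using computable_pred_not[OF computable_pred_conj[OF computable_pred_not[of n c] computable_pred_not[of n d]]] by simp

lemma computable_pred_if: "computable_pred n c \<Longrightarrow> computable_pred n d \<Longrightarrow> computable_pred n e \<Longrightarrow> computable_pred n (\<lambda>xs. if c xs then d xs else e xs)"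
  unfolding computable_pred_def
  by (rule computable_cong[of _ _ "\<lambda>xs. if c xs then (if d xs then 1 else 0) else (if e xs then 1 else 0)"])
    (auto intro!: computable_if[unfolded computable_pred_def])

lemma computable_pred_const: "computable_pred n (\<lambda>xs. c)"
  unfolding computable_pred_def by (rule computable_const)

text \<open>The recursion stays correct for modulus 0, where \<open>x mod 0 = x\<close>: the test
  \<open>Suc r = y\<close> never fires and the remainder keeps growing.\<close>

lemma computable_mod: "computable n f \<Longrightarrow> computable n g \<Longrightarrow> computable n (\<lambda>xs. f xs mod g xs)"
  by (rule computable_app2[of "(mod)"],
      rule computable_rec[of "\<lambda>y. 0" "\<lambda>m r y. if Suc r = y then 0 else Suc r"])
    (auto simp: mod_Suc intro!: computable_zero computable_nth computable_if computable_Suc computable_pred_eq)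

lemma computable_div: "computable n f \<Longrightarrow> computable n g \<Longrightarrow> computable n (\<lambda>xs. f xs div g xs)"
  by (rule computable_app2[of "(div)"],
      rule computable_rec[of "\<lambda>y. 0" "\<lambda>m r y. if Suc m mod y = 0 then Suc r else r"])
    (auto simp: div_Suc intro!: computable_zero computable_nth computable_if computable_Suc computable_pred_eq computable_mod)

lemma computable_prod_encode: "computable n f \<Longrightarrow> computable n g \<Longrightarrow> computable n (\<lambda>xs. prod_encode (f xs, g xs))"
  unfolding prod_encode_def triangle_def split
  by (intro computable_add computable_div computable_mult computable_Suc computable_const) auto

text \<open>The largest \<open>k\<close> with \<open>triangle k \<le> n\<close>, the Cantor diagonal
  containing \<open>n\<close>. Its primitive recursion makes both components of
  \<open>prod_decode\<close> computable.\<close>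

fun diagonal :: "nat \<Rightarrow> nat" where
  "diagonal 0 = 0"
| "diagonal (Suc n) = (if triangle (Suc (diagonal n)) \<le> Suc n then Suc (diagonal n) else diagonal n)"

lemma diagonal_bounds: "triangle (diagonal n) \<le> n \<and> n < triangle (Suc (diagonal n))"
  by (induction n) auto

lemma prod_decode_diagonal:
  "prod_decode n = (n - triangle (diagonal n), diagonal n - (n - triangle (diagonal n)))"
proof -
  have "prod_encode (n - triangle (diagonal n), diagonal n - (n - triangle (diagonal n))) = n"
    using diagonal_bounds[of n] by (auto simp: prod_encode_def)
  then show ?thesis by (metis prod_encode_inverse)
qed

lemma computable_triangle: "computable n f \<Longrightarrow> computable n (\<lambda>xs. triangle (f xs))"
  unfolding triangle_def by (intro computable_div computable_mult computable_Suc computable_const)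

lemma computable_diagonal: "computable n f \<Longrightarrow> computable n (\<lambda>xs. diagonal (f xs))"
  by (rule computable_app2[of "\<lambda>x y. diagonal x" n f "\<lambda>_. 0"],
      rule computable_rec[of "\<lambda>y. 0" "\<lambda>m r y. if triangle (Suc r) < Suc (Suc m) then Suc r else r"])
    (auto simp del: triangle_Suc intro!: computable_zero computable_nth computable_if computable_Suc computable_pred_less computable_triangle)

lemma computable_fst: "computable n f \<Longrightarrow> computable n (\<lambda>xs. fst (prod_decode (f xs)))"
  unfolding prod_decode_diagonal fst_conv by (intro computable_diff computable_triangle computable_diagonal)

lemma computable_snd: "computable n f \<Longrightarrow> computable n (\<lambda>xs. snd (prod_decode (f xs)))"
  unfolding prod_decode_diagonal snd_conv by (intro computable_diff computable_triangle computable_diagonal)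

text \<open>\<open>list_encode\<close> nests from the front, so the recursion builds the list
  backwards: after \<open>j\<close> rounds it holds the code of the last \<open>j\<close>
  entries.\<close>

lemma computable_list_encode_map:
  assumes N: "computable (Suc 0) (\<lambda>xs. N (xs ! 0))" and G: "computable 2 (\<lambda>xs. G (xs ! 0) (xs ! 1))"
  shows "computable (Suc 0) (\<lambda>xs. list_encode (map (\<lambda>i. G i (xs ! 0)) [0..<N (xs ! 0)]))"
proof -
  define F where "F j y = rec_nat 0 (\<lambda>m r. Suc (prod_encode (G (N y - Suc m) y, r))) j" for j y
  have "j \<le> N y \<Longrightarrow> F j y = list_encode (map (\<lambda>i. G i y) [N y - j..<N y])" for j y
  proof (induction j)
    case (Suc j)
    then have "[N y - Suc j..<N y] = (N y - Suc j) # [N y - j..<N y]"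
      by (simp add: upt_rec Suc_diff_Suc)
    with Suc show ?case by (simp add: F_def)
  qed (simp add: F_def)
  then have *: "F (N y) y = list_encode (map (\<lambda>i. G i y) [0..<N y])" for y by simp
  have N2: "computable n f \<Longrightarrow> computable n (\<lambda>xs. N (f xs))" for n f by (rule computable_app1[OF N])
  have "computable 2 (\<lambda>xs. F (xs ! 0) (xs ! 1))"
    by (rule computable_rec[of "\<lambda>y. 0" "\<lambda>m r y. Suc (prod_encode (G (N y - Suc m) y, r))"])
      (auto simp: F_def intro!: computable_zero computable_nth computable_Suc computable_prod_encode N2 computable_diff computable_app2[OF G])
  then have "computable (Suc 0) (\<lambda>xs. F (N (xs ! 0)) (xs ! 0))"
    by (rule computable_app2) (auto intro!: N2 computable_nth)
  then show ?thesis by (simp add: *)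
qed

section \<open>Counter programs for recursive functions\<close>

type_synonym instr = "nat \<times> nat \<times> nat \<times> nat"

text \<open>All opcodes above 1 mean test-and-decrement, so every quadruple of numbers is an
  instruction and every number can be decoded as one.\<close>

definition cstep :: "(nat \<Rightarrow> instr) \<Rightarrow> nat \<times> (nat \<Rightarrow> nat) \<Rightarrow> nat \<times> (nat \<Rightarrow> nat)" where
  "cstep P c = (case c of (p, R) \<Rightarrow> case P p of (op, r, j, k) \<Rightarrow>
     if op = 0 then (p, R)
     else if op = 1 then (j, R(r := Suc (R r)))
     else if R r > 0 then (j, R(r := R r - 1))
     else (k, R))"

definition steps :: "(nat \<Rightarrow> instr) \<Rightarrow> nat \<times> (nat \<Rightarrow> nat) \<Rightarrow> nat \<times> (nat \<Rightarrow> nat) \<Rightarrow> bool" where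
  "steps P c c' \<longleftrightarrow> (\<exists>n. (cstep P ^^ n) c = c')"

definition has_code :: "(nat \<Rightarrow> instr) \<Rightarrow> nat \<Rightarrow> instr list \<Rightarrow> bool" where
  "has_code P s c \<longleftrightarrow> (\<forall>i < length c. P (s + i) = c ! i)"

lemma steps_refl: "steps P c c"
  unfolding steps_def by (rule exI[of _ 0]) simp

lemma steps_trans: "steps P c c' \<Longrightarrow> steps P c' c'' \<Longrightarrow> steps P c c''"
  unfolding steps_def by (metis funpow_add o_apply)

lemma steps_step: "steps P (cstep P c) c' \<Longrightarrow> steps P c c'"
  unfolding steps_def by (metis funpow_simps_right(2) o_apply)

lemma has_code_append:
  "has_code P s (c @ d) \<longleftrightarrow> has_code P s c \<and> has_code P (s + length c) d"
proof
  assume h: "has_code P s (c @ d)"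
  have "P (s + length c + i) = d ! i" if "i < length d" for i
    using h that unfolding has_code_def
    by (metis add.assoc length_append nat_add_left_cancel_less nth_append_length_plus)
  moreover have "has_code P s c" using h unfolding has_code_def
    by (metis length_append nth_append trans_less_add1)
  ultimately show "has_code P s c \<and> has_code P (s + length c) d" by (simp add: has_code_def)
next
  assume h: "has_code P s c \<and> has_code P (s + length c) d"
  show "has_code P s (c @ d)" unfolding has_code_def
  proof (intro allI impI)
    fix i assume i: "i < length (c @ d)"
    show "P (s + i) = (c @ d) ! i"
    proof (cases "i < length c")
      case False
      with i h have "P (s + length c + (i - length c)) = d ! (i - length c)"
        unfolding has_code_def length_append by (metis add_less_cancel_left le_add_diff_inverse not_less)
      with False show ?thesis by (simp add: nth_append)
    qed (use h in \<open>simp add: has_code_def nth_append\<close>)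
  qed
qed

lemma has_code_Cons: "has_code P s (x # d) \<longleftrightarrow> P s = x \<and> has_code P (Suc s) d"
  using has_code_append[of P s "[x]" d] by (simp add: has_code_def)

lemma has_code_Nil: "has_code P s []"
  by (simp add: has_code_def)

section \<open>Clearing and copying registers\<close>

definition clear_code :: "nat \<Rightarrow> nat \<Rightarrow> instr list" where
  "clear_code r s = [(2, r, s, Suc s)]"

text \<open>Reading a register destroys it: \<open>a\<close> is emptied into \<open>b\<close> and
  the scratch register \<open>t\<close>, and then \<open>t\<close> is moved back to
  \<open>a\<close>.\<close>

definition copy_code :: "nat \<Rightarrow> nat \<Rightarrow> nat \<Rightarrow> nat \<Rightarrow> instr list" where
  "copy_code a b t s = clear_code b s @ clear_code t (s + 1) @
     [(2, a, s + 3, s + 5), (1, b, s + 4, 0), (1, t, s + 2, 0),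
      (2, t, s + 6, s + 7), (1, a, s + 5, 0)]"

lemma length_clear_code [simp]: "length (clear_code r s) = 1"
  by (simp add: clear_code_def)

lemma length_copy_code [simp]: "length (copy_code a b t s) = 7"
  by (simp add: copy_code_def)

lemma clear_code_steps:
  assumes "has_code P s (clear_code r s)"
  shows "steps P (s, R) (Suc s, R(r := 0))"
proof (induction "R r" arbitrary: R)
  case 0
  then have "R(r := 0) = R" by (simp add: fun_upd_idem)
  with 0 assms have "cstep P (s, R) = (Suc s, R(r := 0))"
    by (simp add: cstep_def clear_code_def has_code_Cons)
  then show ?case by (metis steps_step steps_refl)
next
  case (Suc x)
  with assms have "cstep P (s, R) = (s, R(r := x))"
    by (simp add: cstep_def clear_code_def has_code_Cons flip: Suc.hyps(2))
  moreover have "steps P (s, R(r := x)) (Suc s, R(r := 0))"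
    using Suc.hyps(1)[of "R(r := x)"] by simp
  ultimately show ?case by (metis steps_step)
qed

lemma copy_code_steps:
  assumes c: "has_code P s (copy_code a b t s)" and d: "distinct [a, b, t]"
  shows "steps P (s, R) (s + 7, R(b := R a, t := 0))"
proof -
  have P: "P (s+2) = (2, a, s + 3, s + 5)" "P (s+3) = (1, b, s + 4, 0)" "P (s+4) = (1, t, s + 2, 0)"
     "P (s+5) = (2, t, s + 6, s + 7)" "P (s+6) = (1, a, s + 5, 0)"
    and c1: "has_code P s (clear_code b s)" and c2: "has_code P (Suc s) (clear_code t (Suc s))"
    using c by (simp_all add: copy_code_def has_code_append has_code_Cons has_code_Nil eval_nat_numeral)
  have A: "steps P (s+2, R) (s+5, R(a := 0, b := R b + R a, t := R t + R a))" for R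
  proof (induction "R a" arbitrary: R)
    case 0
    then have "R(a := 0, b := R b + R a, t := R t + R a) = R" using d by (auto simp: fun_eq_iff)
    with 0 P have "cstep P (s+2, R) = (s+5, R(a := 0, b := R b + R a, t := R t + R a))"
      by (simp add: cstep_def)
    then show ?case by (metis steps_step steps_refl)
  next
    case (Suc x)
    let ?R = "R(a := x, b := R b + 1, t := R t + 1)"
    have "cstep P (cstep P (cstep P (s+2, R))) = (s+2, ?R)"
      using d P Suc(2)[symmetric] by (auto simp: cstep_def fun_eq_iff)
    moreover have "steps P (s+2, ?R) (s+5, ?R(a := 0, b := ?R b + ?R a, t := ?R t + ?R a))"
      by (rule Suc(1)) (use d in auto)
    moreover have "?R(a := 0, b := ?R b + ?R a, t := ?R t + ?R a) = R(a := 0, b := R b + R a, t := R t + R a)"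
      using d Suc(2) by (auto simp: fun_eq_iff)
    ultimately show ?case by (metis steps_step)
  qed
  have B: "steps P (s+5, R) (s+7, R(a := R a + R t, t := 0))" for R
  proof (induction "R t" arbitrary: R)
    case 0
    then have "R(a := R a + R t, t := 0) = R" using d by (auto simp: fun_eq_iff)
    with 0 P have "cstep P (s+5, R) = (s+7, R(a := R a + R t, t := 0))"
      by (simp add: cstep_def)
    then show ?case by (metis steps_step steps_refl)
  next
    case (Suc x)
    let ?R = "R(a := R a + 1, t := x)"
    have "cstep P (cstep P (s+5, R)) = (s+5, ?R)"
      using d P Suc(2)[symmetric] by (auto simp: cstep_def fun_eq_iff)
    moreover have "steps P (s+5, ?R) (s+7, ?R(a := ?R a + ?R t, t := 0))"
      by (rule Suc(1)) (use d in auto)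
    moreover have "?R(a := ?R a + ?R t, t := 0) = R(a := R a + R t, t := 0)"
      using d Suc(2) by (auto simp: fun_eq_iff)
    ultimately show ?case by (metis steps_step)
  qed
  let ?R = "R(b := 0, t := 0)"
  have "steps P (s, R) (s+2, ?R)"
    using steps_trans[OF clear_code_steps[OF c1] clear_code_steps[OF c2]] by simp
  moreover have "steps P (s+2, ?R) (s+7, R(b := R a, t := 0))"
  proof -
    have "?R(a := 0, b := ?R b + ?R a, t := ?R t + ?R a, a := 0 + R a, t := 0) = R(b := R a, t := 0)"
      using d by (auto simp: fun_eq_iff)
    with steps_trans[OF A[of ?R] B] d show ?thesis by (auto simp: fun_upd_twist)
  qed
  ultimately show ?thesis by (rule steps_trans)
qed

text \<open>\<open>compile f as b n s\<close> is code to be placed at address \<open>s\<close>; it evaluates \<open>f\<close> on the registers \<open>as\<close>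
  and leaves the result in register \<open>b\<close>, using the registers from \<open>n\<close> on as scratch space.\<close>
fun compile :: "recf \<Rightarrow> nat list \<Rightarrow> nat \<Rightarrow> nat \<Rightarrow> nat \<Rightarrow> instr list"
  and compile_list :: "recf list \<Rightarrow> nat list \<Rightarrow> nat \<Rightarrow> nat \<Rightarrow> nat \<Rightarrow> instr list" where
  "compile Z as b n s = clear_code b s"
| "compile S as b n s = copy_code (hd as) b n s @ [(1, b, s + 8, 0)]"
| "compile (Id i) as b n s = copy_code (as ! i) b n s"
| "compile (Cn f gs) as b n s =
     (let m = n + length gs; c = compile_list gs as n m s
      in c @ compile f [n..<m] b m (s + length c))"
| "compile (Pr f g) as b n s =
     (let c = compile f (tl as) (n + 1) (n + 4) (s + 8);
          l = s + 8 + length c;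
          d = compile g (n # (n + 1) # tl as) (n + 3) (n + 4) (l + 1);
          e = l + 1 + length d
      in copy_code (hd as) (n + 2) (n + 4) s @ clear_code n (s + 7) @ c @ [(2, n + 2, l + 1, e + 8)] @ d @
         copy_code (n + 3) (n + 1) (n + 4) e @ [(1, n, l, 0)] @ copy_code (n + 1) b (n + 4) (e + 8))"
| "compile (Mn f) as b n s =
     (let c = compile f (n # as) (n + 1) (n + 2) (s + 1);
          e = s + 1 + length c
      in clear_code n s @ c @ [(2, n + 1, e + 1, e + 2), (1, n, s + 1, 0)] @ copy_code n b (n + 2) (e + 2))"
| "compile_list [] as k m s = []"
| "compile_list (g # gs) as k m s =
     (let c = compile g as k m s in c @ compile_list gs as (Suc k) m (s + length c))"

definition runs_to :: "(nat \<Rightarrow> instr) \<Rightarrow> nat \<Rightarrow> (nat \<Rightarrow> nat) \<Rightarrow> nat \<Rightarrow> nat \<Rightarrow> nat \<Rightarrow> nat \<Rightarrow> bool" where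
  "runs_to P s R t n b y \<longleftrightarrow>
     (\<exists>R'. steps P (s, R) (t, R') \<and> R' b = y \<and> (\<forall>i<n. i \<noteq> b \<longrightarrow> R' i = R i))"

text \<open>That all registers below \<open>n\<close> except \<open>b\<close> survive is what the
  induction lives on: it protects the arguments and loop counters while a subterm is evaluated with
  scratch space further up.\<close>

lemma compile_correct:
  "eval_rf f xs y \<Longrightarrow> has_code P s (compile f as b n s) \<Longrightarrow> map R as = xs \<Longrightarrow>
   set as \<subseteq> {..<n} \<Longrightarrow> b < n \<Longrightarrow> b \<notin> set as \<Longrightarrow>
   runs_to P s R (s + length (compile f as b n s)) n b y"
proof (induction f arbitrary: xs y s as b n R)
  case Z
  then have "y = 0" by (auto elim: eval_rf.cases)
  moreover have "steps P (s, R) (Suc s, R(b := 0))" using Z by (intro clear_code_steps) simp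
  ultimately show ?case by (auto simp: runs_to_def intro!: exI[of _ "R(b := 0)"])
next
  case S
  from S(1) obtain x where x: "xs = [x]" "y = Suc x" by (auto elim: eval_rf.cases)
  with S(3) obtain a where a: "as = [a]" "R a = x" by auto
  have "steps P (s, R) (s + 7, R(b := R a, n := 0))"
    using S a by (intro copy_code_steps) (auto simp: has_code_append)
  moreover have "P (s + 7) = (1, b, s + 8, 0)" using S(2) by (simp add: has_code_append has_code_Cons)
  then have "cstep P (s + 7, R(b := R a, n := 0)) = (s + 8, R(b := Suc (R a), n := 0))"
    using S(5) by (auto simp: cstep_def fun_eq_iff)
  ultimately have "steps P (s, R) (s + 8, R(b := Suc (R a), n := 0))"
    by (metis steps_trans steps_step steps_refl)
  with S x a show ?case by (auto simp: runs_to_def intro!: exI[of _ "R(b := Suc (R a), n := 0)"])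
next
  case (Id i)
  from Id(1) have i: "i < length xs" "y = xs ! i" by (auto elim: eval_rf.cases)
  then have "as ! i \<in> set as" using Id(3) by auto
  then have "steps P (s, R) (s + 7, R(b := R (as ! i), n := 0))"
    using Id by (intro copy_code_steps) auto
  with i Id show ?case by (auto simp: runs_to_def intro!: exI[of _ "R(b := R (as ! i), n := 0)"])
next
  case (Cn f gs)
  from Cn.prems(1) obtain ys where ys: "list_all2 (\<lambda>g y. eval_rf g xs y) gs ys" "eval_rf f ys y"
    by (auto elim: eval_rf.cases)
  \<comment> \<open>The values of the inner functions pile up in consecutive registers from
    \<open>k\<close> on. The scratch space starts above all of them, at the same register throughout
    the list, so earlier values survive.\<close>
  have lst: "list_all2 (\<lambda>g y. eval_rf g xs y) hs zs \<Longrightarrow> set hs \<subseteq> set gs \<Longrightarrow>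
      has_code P s (compile_list hs as k (k + length hs) s) \<Longrightarrow> map R as = xs \<Longrightarrow> n \<le> k \<Longrightarrow>
      \<exists>R'. steps P (s, R) (s + length (compile_list hs as k (k + length hs) s), R') \<and>
        map R' [k..<k + length hs] = zs \<and> (\<forall>i<k. R' i = R i)" for hs zs s k R
  proof (induction hs arbitrary: zs s k R)
    case Nil
    then show ?case by (auto intro!: exI[of _ R] steps_refl)
  next
    case (Cons h hs)
    then obtain z zs' where z: "zs = z # zs'" "eval_rf h xs z" "list_all2 (\<lambda>g y. eval_rf g xs y) hs zs'"
      by (auto simp: list_all2_Cons1)
    define c where "c = compile h as k (Suc (k + length hs)) s"
    have code: "has_code P s c" "has_code P (s + length c) (compile_list hs as (Suc k) (Suc k + length hs) (s + length c))"
      using Cons.prems(3) by (simp_all add: c_def Let_def has_code_append)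
    have "runs_to P s R (s + length c) (Suc (k + length hs)) k z"
      unfolding c_def
      by (rule Cn.IH(2)[OF _ z(2)]) (use Cons.prems code Cn.prems in \<open>auto simp: c_def\<close>)
    then obtain R1 where R1: "steps P (s, R) (s + length c, R1)" "R1 k = z"
      "\<And>i. i < Suc (k + length hs) \<Longrightarrow> i \<noteq> k \<Longrightarrow> R1 i = R i"
      by (auto simp: runs_to_def)
    have "map R1 as = map R as" using R1(3) Cn.prems(4) Cons.prems(5) by (force simp: map_eq_conv)
    then obtain R2 where R2: "steps P (s + length c, R1)
         (s + length c + length (compile_list hs as (Suc k) (Suc k + length hs) (s + length c)), R2)"
       "map R2 [Suc k..<Suc k + length hs] = zs'" "\<forall>i<Suc k. R2 i = R1 i"
      using Cons.IH[OF z(3) _ code(2), of R1] Cons.prems by auto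
    from R1 R2 z(1) show ?case
      by (auto simp: c_def Let_def upt_rec[of k] add.assoc
          simp del: upt_Suc intro!: exI[of _ R2] elim: steps_trans)
  qed
  let ?m = "n + length gs"
  let ?c = "compile_list gs as n ?m s"
  have code: "has_code P s ?c" "has_code P (s + length ?c) (compile f [n..<?m] b ?m (s + length ?c))"
    using Cn.prems(2) by (simp_all add: Let_def has_code_append)
  from lst[OF ys(1) _ code(1)] Cn.prems obtain R1 where
    R1: "steps P (s, R) (s + length ?c, R1)" "map R1 [n..<?m] = ys" "\<forall>i<n. R1 i = R i" by auto
  have "runs_to P (s + length ?c) R1 (s + length ?c + length (compile f [n..<?m] b ?m (s + length ?c))) ?m b y"
    by (rule Cn.IH(1)[OF ys(2) code(2) R1(2)]) (use Cn.prems in auto)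
  with R1 show ?case
    by (auto simp: runs_to_def Let_def add.assoc intro: steps_trans)
next
  \<comment> \<open>Register \<open>n\<close> counts the finished rounds, \<open>n + 1\<close> holds
    the current value, \<open>n + 2\<close> the rounds left. The new value goes to
    \<open>n + 3\<close> first, since \<open>g\<close> reads \<open>n + 1\<close> and a target must
    not be an argument.\<close>
  case (Pr f g)
  from Pr.prems(1) obtain N ws where xs: "xs = N # ws" by (auto elim: eval_rf.cases)
  with Pr.prems(3) obtain a as' where as: "as = a # as'" "R a = N" "map R as' = ws" by auto
  define c where "c = compile f as' (n + 1) (n + 4) (s + 8)"
  define l where "l = s + 8 + length c"
  define d where "d = compile g (n # (n + 1) # as') (n + 3) (n + 4) (l + 1)"
  define e where "e = l + 1 + length d"
  have whole: "compile (Pr f g) as b n s = copy_code a (n + 2) (n + 4) s @ clear_code n (s + 7) @ c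
      @ [(2, n + 2, l + 1, e + 8)] @ d @ copy_code (n + 3) (n + 1) (n + 4) e @ [(1, n, l, 0)]
      @ copy_code (n + 1) b (n + 4) (e + 8)"
    by (simp add: as c_def d_def e_def l_def Let_def add.assoc)
  have code: "has_code P s (copy_code a (n + 2) (n + 4) s)" "has_code P (s + 7) (clear_code n (s + 7))"
    "has_code P (s + 8) c" "P l = (2, n + 2, l + 1, e + 8)" "has_code P (l + 1) d"
    "has_code P e (copy_code (n + 3) (n + 1) (n + 4) e)" "P (e + 7) = (1, n, l, 0)"
    "has_code P (e + 8) (copy_code (n + 1) b (n + 4) (e + 8))"
    using Pr.prems(2) unfolding whole
    by (simp_all add: has_code_append has_code_Cons e_def l_def add.assoc add.commute add.left_commute)
  have an: "a < n" "set as' \<subseteq> {..<n}" "b \<notin> set as'" "b \<noteq> a" "b < n" using Pr.prems as by auto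
  have loop: "m \<le> N \<Longrightarrow> eval_rf (Pr f g) (m # ws) r \<Longrightarrow>
    \<exists>R'. steps P (s, R) (l, R') \<and> R' n = m \<and> R' (n + 1) = r \<and> R' (n + 2) = N - m \<and> (\<forall>i<n. R' i = R i)" for m r
  proof (induction m arbitrary: r)
    case 0
    then have ev: "eval_rf f ws r" by (auto elim: eval_rf.cases)
    let ?R = "R(n + 2 := N, n + 4 := 0, n := 0)"
    have "steps P (s, R) (s + 8, ?R)"
      using steps_trans[OF copy_code_steps[OF code(1), of R] clear_code_steps[OF code(2)]] an as(2)
      by (simp add: eval_nat_numeral)
    moreover have "runs_to P (s + 8) ?R (s + 8 + length c) (n + 4) (n + 1) r"
      unfolding c_def
    proof (rule Pr.IH(1)[OF ev])
      have "map ?R as' = map R as'" by (rule map_cong) (use an in auto)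
      then show "map ?R as' = ws" using as by simp
    qed (use an code in \<open>auto simp: c_def\<close>)
    ultimately show ?case unfolding runs_to_def
      by (auto simp: l_def intro: steps_trans)
  next
    case (Suc m)
    from Suc.prems(2) obtain r' where r': "eval_rf (Pr f g) (m # ws) r'" "eval_rf g (m # r' # ws) r"
      by (auto elim: eval_rf.cases)
    from Suc.IH[OF _ r'(1)] Suc.prems(1) obtain R1 where
      R1: "steps P (s, R) (l, R1)" "R1 n = m" "R1 (n + 1) = r'" "R1 (n + 2) = N - m" "\<forall>i<n. R1 i = R i"
      by auto
    let ?R2 = "R1(n + 2 := N - Suc m)"
    have "cstep P (l, R1) = (l + 1, ?R2)" using code(4) R1 Suc.prems(1) by (simp add: cstep_def)
    then have s1: "steps P (l, R1) (l + 1, ?R2)" by (metis steps_step steps_refl)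
    have "runs_to P (l + 1) ?R2 (l + 1 + length d) (n + 4) (n + 3) r"
      unfolding d_def
    proof (rule Pr.IH(2)[OF r'(2)])
      show "map ?R2 (n # (n + 1) # as') = m # r' # ws"
        using R1 an as by (force simp: map_eq_conv)
    qed (use an code in \<open>auto simp: d_def\<close>)
    then obtain R3 where R3: "steps P (l + 1, ?R2) (e, R3)" "R3 (n + 3) = r"
      "\<forall>i<n + 4. i \<noteq> n + 3 \<longrightarrow> R3 i = ?R2 i" by (auto simp: runs_to_def e_def)
    let ?R4 = "R3(n + 1 := r, n + 4 := 0)"
    have "steps P (e, R3) (e + 7, ?R4)" using copy_code_steps[OF code(6), of R3] R3(2) by simp
    moreover have "cstep P (e + 7, ?R4) = (l, ?R4(n := Suc m))"
      using code(7) R3(3) R1(2) by (simp add: cstep_def)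
    ultimately have "steps P (e, R3) (l, ?R4(n := Suc m))" by (metis steps_step steps_refl steps_trans)
    with R1(1) s1 R3(1) have fin: "steps P (s, R) (l, ?R4(n := Suc m))" by (metis steps_trans)
    show ?case
      by (intro exI[of _ "?R4(n := Suc m)"] conjI, rule fin) (use R3(3) R1(5) in auto)
  qed
  from loop[of N y] Pr.prems(1) xs obtain R1 where
    R1: "steps P (s, R) (l, R1)" "R1 (n + 1) = y" "R1 (n + 2) = 0" "\<forall>i<n. R1 i = R i" by auto
  have "cstep P (l, R1) = (e + 8, R1)" using code(4) R1 by (simp add: cstep_def)
  moreover have "steps P (e + 8, R1) (e + 15, R1(b := y, n + 4 := 0))"
    using copy_code_steps[OF code(8), of R1] an R1 by (simp add: add.assoc)
  ultimately have "steps P (s, R) (e + 15, R1(b := y, n + 4 := 0))"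
    using R1(1) steps_step steps_trans by metis
  moreover have "s + length (compile (Pr f g) as b n s) = e + 15"
    unfolding whole by (simp add: e_def l_def)
  ultimately show ?case using R1 an by (auto simp: runs_to_def intro!: exI[of _ "R1(b := y, n + 4 := 0)"])
next
  case (Mn f)
  define c where "c = compile f (n # as) (n + 1) (n + 2) (s + 1)"
  define e where "e = s + 1 + length c"
  have whole: "compile (Mn f) as b n s = clear_code n s @ c @ [(2, n + 1, e + 1, e + 2), (1, n, s + 1, 0)]
      @ copy_code n b (n + 2) (e + 2)"
    by (simp add: c_def e_def Let_def)
  have code: "has_code P s (clear_code n s)" "has_code P (s + 1) c" "P e = (2, n + 1, e + 1, e + 2)"
    "P (e + 1) = (1, n, s + 1, 0)" "has_code P (e + 2) (copy_code n b (n + 2) (e + 2))"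
    using Mn.prems(2) unfolding whole
    by (simp_all add: has_code_append has_code_Cons e_def add.assoc add.commute add.left_commute)
  from Mn.prems(1) have ev: "eval_rf f (y # xs) 0" "\<forall>m<y. \<exists>z. eval_rf f (m # xs) z \<and> z \<noteq> 0"
    by (auto elim: eval_rf.cases)
  have body: "\<exists>R2. steps P (s + 1, R1) (e, R2) \<and> R2 n = m \<and> R2 (n + 1) = z \<and> (\<forall>i<n. R2 i = R i)"
    if "eval_rf f (m # xs) z" "R1 n = m" "\<forall>i<n. R1 i = R i" for m z R1
  proof -
    have "runs_to P (s + 1) R1 (s + 1 + length c) (n + 2) (n + 1) z"
      unfolding c_def
    proof (rule Mn.IH[OF that(1)])
      show "map R1 (n # as) = m # xs" using that Mn.prems by (force simp: map_eq_conv)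
    qed (use Mn.prems code in \<open>auto simp: c_def\<close>)
    with that show ?thesis by (auto simp: runs_to_def e_def)
  qed
  have loop: "m \<le> y \<Longrightarrow> \<exists>R1. steps P (s, R) (s + 1, R1) \<and> R1 n = m \<and> (\<forall>i<n. R1 i = R i)" for m
  proof (induction m)
    case 0
    from clear_code_steps[OF code(1), of R] show ?case by (auto intro!: exI[of _ "R(n := 0)"])
  next
    case (Suc m)
    then obtain R1 where R1: "steps P (s, R) (s + 1, R1)" "R1 n = m" "\<forall>i<n. R1 i = R i" by auto
    from ev(2) Suc.prems obtain z where z: "eval_rf f (m # xs) z" "z \<noteq> 0" by (meson Suc_le_lessD)
    from body[OF z(1) R1(2,3)] obtain R2 where R2: "steps P (s + 1, R1) (e, R2)" "R2 n = m"
      "R2 (n + 1) = z" "\<forall>i<n. R2 i = R i" by auto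
    let ?R3 = "R2(n + 1 := z - 1, n := Suc m)"
    have "cstep P (cstep P (e, R2)) = (s + 1, ?R3)"
      using R2 z(2) code by (simp add: cstep_def)
    then have "steps P (e, R2) (s + 1, ?R3)" by (metis steps_step steps_refl)
    with R1 R2 have fin: "steps P (s, R) (s + 1, ?R3)" by (metis steps_trans)
    show ?case by (intro exI[of _ ?R3] conjI, rule fin) (use R2 in auto)
  qed
  from loop[of y] obtain R1 where R1: "steps P (s, R) (s + 1, R1)" "R1 n = y" "\<forall>i<n. R1 i = R i" by auto
  from body[OF ev(1) R1(2,3)] obtain R2 where R2: "steps P (s + 1, R1) (e, R2)" "R2 n = y"
    "R2 (n + 1) = 0" "\<forall>i<n. R2 i = R i" by auto
  have "cstep P (e, R2) = (e + 2, R2)" using code(3) R2 by (simp add: cstep_def)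
  moreover have "steps P (e + 2, R2) (e + 9, R2(b := y, n + 2 := 0))"
    using copy_code_steps[OF code(5), of R2] Mn.prems R2 by (simp add: add.commute)
  ultimately have "steps P (s, R) (e + 9, R2(b := y, n + 2 := 0))"
    using R1(1) R2(1) steps_step steps_trans by metis
  moreover have "s + length (compile (Mn f) as b n s) = e + 9"
    unfolding whole by (simp add: e_def)
  ultimately show ?case using R2 Mn.prems
    by (auto simp: runs_to_def intro!: exI[of _ "R2(b := y, n + 2 := 0)"])
qed

section \<open>Acceptance by universal automata\<close>

definition reach :: "ata \<Rightarrow> (nat \<Rightarrow> nat \<times> real) \<Rightarrow> pos \<Rightarrow> bool" where
  "reach A w = (edge A w)\<^sup>*\<^sup>* (Conf 0 (init A) 0)"

definition path :: "ata \<Rightarrow> (nat \<Rightarrow> nat \<times> real) \<Rightarrow> (nat \<Rightarrow> pos) \<Rightarrow> bool" where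
  "path A w p \<longleftrightarrow> (\<forall>n. edge A w (p n) (p (Suc n)))"

text \<open>An invariant of the game: no disjunction ever comes up, so Eve never has to move, and
  all states stay in the range where ranks are defined.\<close>

fun legal_pos :: "ata \<Rightarrow> pos \<Rightarrow> bool" where
  "legal_pos A (Conf k q v) = (q < nstates A)"
| "legal_pos A (Frm k v \<phi>) = (atoms_bf \<phi> \<subseteq> {..<nstates A} \<and> \<not> has_or \<phi>)"
| "legal_pos A _ = True"

lemma edge_legal_pos:
  assumes "edge A w x y" "legal_pos A x" "wf_ata A" "universal_ata A"
  shows "legal_pos A y"
  using assms by cases (force simp: wf_ata_def universal_ata_def)+

lemma path_legal_pos:
  assumes "path A w p" "legal_pos A (p 0)" "wf_ata A" "universal_ata A"
  shows "legal_pos A (p n)"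
proof (induction n)
  case (Suc n)
  with assms show ?case unfolding path_def by (metis edge_legal_pos)
qed (rule assms(2))

lemma reach_legal_pos:
  assumes "reach A w x" "wf_ata A" "universal_ata A"
  shows "legal_pos A x"
  using assms(1) unfolding reach_def
proof (induction rule: rtranclp_induct)
  case base
  show ?case using assms(2) by (simp add: wf_ata_def)
next
  case (step y z)
  with assms(2,3) show ?case by (metis edge_legal_pos)
qed

lemma legal_pos_not_eve: "legal_pos A x \<Longrightarrow> \<not> eve_pos x"
  by (cases x rule: eve_pos.cases) auto

lemma path_reach:
  assumes "path A w p" "p 0 = Conf 0 (init A) 0"
  shows "reach A w (p n)"
  by (induction n) (use assms in \<open>auto simp: reach_def path_def intro: rtranclp.rtrancl_into_rtrancl\<close>)

lemma edge_exists: "\<exists>y. edge A w x y"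
proof (cases x)
  case (Conf k q v)
  then show ?thesis by (cases "\<exists>\<theta> \<phi>. (q, fst (w k), \<theta>, \<phi>) \<in> set (delta A) \<and>
    sat_cc \<theta> (v + tstamp w (Suc k) - tstamp w k)") (auto intro: edge.intros)
next
  case (Frm k v \<phi>)
  then show ?thesis by (cases \<phi>) (auto intro: edge.intros)
qed (auto intro: edge.intros)

text \<open>As Eve owns no legal position, every path from the initial configuration is consistent
  with every strategy.\<close>

lemma accepts_iff_paths:
  assumes "wf_ata A" "universal_ata A"
  shows "accepts A w \<longleftrightarrow> (\<forall>p. p 0 = Conf 0 (init A) 0 \<longrightarrow> path A w p \<longrightarrow> eve_wins_play A p)"
proof
  assume "accepts A w"
  then obtain \<sigma> where \<sigma>: "\<And>p. play_consistent A w \<sigma> p \<Longrightarrow> eve_wins_play A p"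
    unfolding accepts_def by blast
  show "\<forall>p. p 0 = Conf 0 (init A) 0 \<longrightarrow> path A w p \<longrightarrow> eve_wins_play A p"
  proof (intro allI impI)
    fix p assume p: "p 0 = Conf 0 (init A) 0" "path A w p"
    then have "\<not> eve_pos (p n)" for n
      using path_legal_pos[OF p(2) _ assms] legal_pos_not_eve assms(1) by (auto simp: wf_ata_def)
    with p show "eve_wins_play A p" by (intro \<sigma>) (auto simp: play_consistent_def path_def)
  qed
next
  assume "\<forall>p. p 0 = Conf 0 (init A) 0 \<longrightarrow> path A w p \<longrightarrow> eve_wins_play A p"
  moreover have "eve_strategy A w (\<lambda>h. SOME y. edge A w (last h) y)"
    unfolding eve_strategy_def by (meson edge_exists someI_ex)
  ultimately show "accepts A w"
    unfolding accepts_def play_consistent_def path_def by blast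
qed

lemma reach_extend_path:
  assumes "(edge A w)\<^sup>*\<^sup>* x y" "path A w s" "s 0 = y"
  shows "\<exists>p m. p 0 = x \<and> path A w p \<and> (\<forall>n. p (m + n) = s n)"
  using assms(1)
proof (induction rule: converse_rtranclp_induct)
  case base
  show ?case using assms by (intro exI[of _ s] exI[of _ 0]) auto
next
  case (step x z)
  then obtain p m where p: "p 0 = z" "path A w p" "\<forall>n. p (m + n) = s n" by blast
  have "path A w (case_nat x p)"
    unfolding path_def using step(1) p by (auto simp: path_def split: nat.split)
  with p show ?case by (intro exI[of _ "case_nat x p"] exI[of _ "Suc m"]) auto
qed

lemma path_win_stays: "path A w p \<Longrightarrow> p n = WinSink \<Longrightarrow> p (n + m) = WinSink"
proof (induction m)
  case (Suc m)
  then have "edge A w WinSink (p (n + Suc m))" unfolding path_def by (metis add_Suc_right)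
  then show ?case by cases auto
qed simp

text \<open>A finite path to the losing sink extends to a play that stays there. It never meets
  \<open>WinSink\<close>, because that sink cannot be left either.\<close>

lemma accepts_not_lose:
  assumes "wf_ata A" "universal_ata A" "accepts A w"
  shows "\<not> reach A w LoseSink"
proof
  assume lose: "reach A w LoseSink"
  have "path A w (\<lambda>_. LoseSink)" unfolding path_def by (simp add: e_lose)
  from reach_extend_path[OF lose[unfolded reach_def] this refl] obtain p m
    where p: "p 0 = Conf 0 (init A) 0" "path A w p" "\<And>n. p (m + n) = LoseSink" by auto
  from p accepts_iff_paths[OF assms(1,2)] assms(3) have "eve_wins_play A p" by blast
  with p(3) obtain n where "p n = WinSink" unfolding eve_wins_play_def by blast
  then have "p (m + n) = WinSink" using path_win_stays[OF p(2)] by (metis add.commute)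
  with p(3) show False by simp
qed

text \<open>No rank is 0, so the minimum rank of such a play is 1, which is odd; only
  \<open>WinSink\<close> can win it.\<close>

lemma accepts_rank_one_wins:
  assumes A: "wf_ata A" "universal_ata A" "weak_index_1_2 A" "accepts A w"
    and s: "reach A w (s 0)" "path A w s" "s 0 = Conf k q v" "rank A q = 1"
  shows "\<exists>n. s n = WinSink"
proof -
  from reach_extend_path[OF s(1)[unfolded reach_def] s(2) refl] obtain p m
    where p: "p 0 = Conf 0 (init A) 0" "path A w p" "\<And>n. p (m + n) = s n" by auto
  from p accepts_iff_paths[OF A(1,2)] A(4) have win: "eve_wins_play A p" by blast
  show ?thesis
  proof (cases "\<exists>n. p n = WinSink")
    case True
    then show ?thesis using path_win_stays[OF p(2)] p(3) by (metis add.commute)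
  next
    case False
    let ?Q = "\<lambda>r. \<exists>n k q v. p n = Conf k q v \<and> r = rank A q"
    define r where "r = (LEAST r. ?Q r)"
    from False win have ev: "even r" unfolding eve_wins_play_def r_def by blast
    have "?Q 1" using p(3)[of 0] s(3,4) by metis
    then have Q: "?Q r" and le: "r \<le> 1"
      unfolding r_def by (rule LeastI, rule Least_le)
    from le ev have "r = 0" by presburger
    with Q obtain n k' q' v' where q': "p n = Conf k' q' v'" "rank A q' = 0" by auto
    then have "q' < nstates A" using path_legal_pos[OF p(2) _ A(1,2), of n] p(1) A(1)
      by (auto simp: wf_ata_def)
    then have "rank A q' \<in> {1, 2}" using A(1,3)
      by (metis (no_types, lifting) nth_mem rank_def subsetD wf_ata_def weak_index_1_2_def)
    with q' show ?thesis by simp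
  qed
qed

lemma accepts_intro:
  assumes A: "wf_ata A" "universal_ata A" "weak_index_1_2 A"
    and lose: "\<not> reach A w LoseSink"
    and live: "\<And>p n k q v. p 0 = Conf 0 (init A) 0 \<Longrightarrow> path A w p \<Longrightarrow> p n = Conf k q v \<Longrightarrow>
       rank A q = 1 \<Longrightarrow> \<exists>n. p n = WinSink"
  shows "accepts A w"
  unfolding accepts_iff_paths[OF A(1,2)]
proof (intro allI impI)
  fix p assume p: "p 0 = Conf 0 (init A) 0" "path A w p"
  have nl: "p n \<noteq> LoseSink" for n using path_reach[OF p(2,1), of n] lose by metis
  show "eve_wins_play A p"
  proof (cases "\<exists>n. p n = WinSink")
    case False
    have r2: "rank A q = 2" if "p n = Conf k q v" for n k q v
    proof -
      have "q < nstates A" using path_legal_pos[OF p(2) _ A(1,2), of n] p(1) A(1) that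
        by (auto simp: wf_ata_def)
      then have "rank A q \<in> {1, 2}" using A
        by (metis (no_types, lifting) nth_mem rank_def subsetD wf_ata_def weak_index_1_2_def)
      with live[OF p that] False show ?thesis by auto
    qed
    have "(LEAST r. \<exists>n k q v. p n = Conf k q v \<and> r = rank A q) = 2"
      by (rule Least_equality) (use r2 p(1) in \<open>metis, auto\<close>)
    with nl show ?thesis unfolding eve_wins_play_def by simp
  qed (simp add: eve_wins_play_def)
qed

section \<open>Block automata\<close>

text \<open>A timed word is cut into blocks, each consisting of a control letter \<open>l < L\<close> followed by items of
  types \<open>t < T\<close>. In a block controlled by \<open>l\<close>, the first item whose type satisfies \<open>sel l\<close> becomes \<open>res l\<close> in the
  next block, every other item of type \<open>t\<close> becomes \<open>dft l t\<close>, the types \<open>forb l\<close> must not occur, and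
  the next control letter \<open>l'\<close> must satisfy \<open>nxt l l'\<close>. Letter \<open>2 * t + b\<close> is an item of type \<open>t\<close> with parity \<open>b\<close>,
  and letter \<open>2 * T + l\<close> is a control letter. Parities alternate along a block, so that no two items can
  share their image. Under control letter 0 the parity of the images is flipped, which forces at
  least one additional item in the next block.\<close>
locale block_ata =
  fixes T L :: nat
    and sel forb :: "nat \<Rightarrow> nat \<Rightarrow> bool"
    and res :: "nat \<Rightarrow> nat" and dft :: "nat \<Rightarrow> nat \<Rightarrow> nat"
    and nxt :: "nat \<Rightarrow> nat \<Rightarrow> bool"
  assumes L_pos: "0 < L" and T_pos: "0 < T"
    and res_less: "res l < T" and dft_less: "t < T \<Longrightarrow> dft l t < T"
begin

definition nlet :: nat where "nlet = 2 * T + L"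
definition nst :: nat where "nst = 2 * T + 4 * L + 2"
definition start :: nat where "start = 2 * T + 4 * L"
definition wait :: nat where "wait = 2 * T + 4 * L + 1"
definition main :: "nat \<Rightarrow> nat \<Rightarrow> nat \<Rightarrow> nat" where "main l f b = 2 * T + 4 * l + 2 * f + b"

definition img :: "nat \<Rightarrow> nat \<Rightarrow> nat \<Rightarrow> nat" where
  "img l f t = (if f = 0 \<and> sel l t then res l else dft l t)"

definition par :: "nat \<Rightarrow> nat \<Rightarrow> nat" where
  "par l b = (if l = 0 then 1 - b else b)"

text \<open>A state \<open>q < 2 * T\<close> waits for the first event more than one time unit later and checks that it is the letter \<open>q\<close>.
  State \<open>main l f b\<close> scans a block controlled by \<open>l\<close>; \<open>f\<close> records whether a selected item was seen, and \<open>b\<close> is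
  the parity of the next item. State \<open>wait\<close>, the only one of rank 1, must eventually see control letter 0: this
  liveness obligation is expressible because a branch that ends in \<open>BTrue\<close> is won whatever its ranks are.\<close>
definition trans :: "nat \<Rightarrow> nat \<Rightarrow> bool \<Rightarrow> bform" where
  "trans q a late =
     (if q < 2 * T then (if late then (if a = q then BTrue else BFalse) else BAtom q Nop)
      else if q = wait then (if a = 2 * T then BTrue else BAtom q Nop)
      else if q = start then
        (if a = 2 * T then BAnd (BAtom (main 0 0 0) Reset) (BAtom wait Nop) else BFalse)
      else if a < 2 * T then
        (if \<not> late \<and> a mod 2 = (q - 2 * T) mod 2 \<and> \<not> forb ((q - 2 * T) div 4) (a div 2) then
          BAnd (BAtom (main ((q - 2 * T) div 4)
                  (if sel ((q - 2 * T) div 4) (a div 2) then 1 else (q - 2 * T) div 2 mod 2)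
                  (1 - (q - 2 * T) mod 2)) Nop)
               (BAtom (2 * img ((q - 2 * T) div 4) ((q - 2 * T) div 2 mod 2) (a div 2)
                  + par ((q - 2 * T) div 4) ((q - 2 * T) mod 2)) Reset)
         else BFalse)
      else if late \<and> (q - 2 * T) div 2 mod 2 = 1 \<and> nxt ((q - 2 * T) div 4) (a - 2 * T) then
        BAnd (BAtom (main (a - 2 * T) 0 0) Reset) (BAtom wait Nop)
      else BFalse)"

text \<open>A mixed radix code of state, letter and clock range by one number. It makes the
  transition list a map over an interval, the form that \<open>computable_list_encode_map\<close>
  handles.\<close>

definition entry :: "nat \<Rightarrow> nat \<times> nat \<times> cc \<times> bform" where
  "entry i = (i div (2 * nlet), i div 2 mod nlet,
     if i mod 2 = 0 then CAtom CmpLe 1 else CAtom CmpGt 1,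
     trans (i div (2 * nlet)) (i div 2 mod nlet) (i mod 2 \<noteq> 0))"

definition aut :: ata where
  "aut = \<lparr>nstates = nst, nletters = nlet, init = start,
     delta = map entry [0..<nst * (2 * nlet)],
     omega = map (\<lambda>q. if q = wait then 1 else 2) [0..<nst]\<rparr>"

lemma aut_simps [simp]:
  "nstates aut = nst" "nletters aut = nlet" "init aut = start"
  by (simp_all add: aut_def)

lemma delta_aut:
  "(q, a, \<theta>, \<phi>) \<in> set (delta aut) \<longleftrightarrow> q < nst \<and> a < nlet \<and>
     (\<exists>late. \<theta> = (if late then CAtom CmpGt 1 else CAtom CmpLe 1) \<and> \<phi> = trans q a late)"
  (is "?l = ?r")
proof
  have nl: "0 < nlet" using T_pos by (simp add: nlet_def)
  assume ?l
  then obtain i where "i < nst * (2 * nlet)" "(q, a, \<theta>, \<phi>) = entry i" by (auto simp: aut_def)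
  with nl show ?r by (auto simp: entry_def less_mult_imp_div_less intro!: exI[of _ "i mod 2 \<noteq> 0"])
next
  assume r: ?r
  then obtain late where late: "\<theta> = (if late then CAtom CmpGt 1 else CAtom CmpLe 1)" "\<phi> = trans q a late" by auto
  let ?i = "(q * nlet + a) * 2 + of_bool late"
  have d: "?i div (2 * nlet) = q" "?i div 2 mod nlet = a" "?i mod 2 = of_bool late"
    using r by (simp_all add: div_mult2_eq mod_Suc)
  have "q * nlet + a < Suc q * nlet" using r by simp
  also have "\<dots> \<le> nst * nlet" using r by (intro mult_le_mono1) simp
  finally have "q * nlet + a < nst * nlet" .
  then have "?i < nst * nlet * 2" by (cases late) simp_all
  then have "?i < nst * (2 * nlet)" by (simp add: algebra_simps)
  moreover have "entry ?i = (q, a, \<theta>, \<phi>)" unfolding entry_def d using late by auto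
  ultimately show ?l unfolding aut_def by (metis (no_types, lifting) atLeast0LessThan image_eqI lessThan_iff list.set_map
    select_convs(4) set_upt)
qed

lemma main_less: "l < L \<Longrightarrow> f \<le> 1 \<Longrightarrow> b \<le> 1 \<Longrightarrow> main l f b < nst"
  by (simp add: main_def nst_def)

lemma trans_atoms: "q < nst \<Longrightarrow> a < nlet \<Longrightarrow> atoms_bf (trans q a late) \<subseteq> {..<nst}"
proof -
  assume h: "q < nst" "a < nlet"
  have i: "img l f t < T" if "t < T" for l f t
    using that res_less dft_less by (simp add: img_def)
  have p: "par l (x mod 2) < 2" for l x by (auto simp: par_def)
  have A: "2 * img l f (a div 2) + par l (x mod 2) < nst" if "a < 2 * T" for l f x
  proof -
    have "a div 2 < T" using that by linarith
    then show ?thesis using i[of "a div 2" l f] p[of l x] by (simp add: nst_def)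
  qed
  have B: "main ((q - 2 * T) div 4) (if c then 1 else (q - 2 * T) div 2 mod 2) (1 - (q - 2 * T) mod 2) < nst"
    if "q \<noteq> start" "q \<noteq> wait" "\<not> q < 2 * T" for c
  proof -
    have "(q - 2 * T) div 4 < L" using that h by (simp add: start_def wait_def nst_def)
    then show ?thesis by (rule main_less) auto
  qed
  have "main (a - 2 * T) 0 0 < nst" "main 0 0 0 < nst" "wait < nst"
    using h L_pos by (auto simp: main_def nst_def nlet_def wait_def)
  note C = this
  have atoms_if: "(c \<Longrightarrow> atoms_bf \<phi> \<subseteq> X) \<Longrightarrow> (\<not> c \<Longrightarrow> atoms_bf \<psi> \<subseteq> X) \<Longrightarrow>
    atoms_bf (if c then \<phi> else \<psi>) \<subseteq> X" for c \<phi> \<psi> X by simp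
  show ?thesis unfolding trans_def
    by (intro atoms_if) (use A B C h(1) in \<open>simp_all only: atoms_bf.simps, simp_all\<close>)
qed

lemma trans_no_or: "\<not> has_or (trans q a late)"
proof -
  have no_or_if: "\<not> has_or \<phi> \<Longrightarrow> \<not> has_or \<psi> \<Longrightarrow> \<not> has_or (if c then \<phi> else \<psi>)" for c \<phi> \<psi> by simp
  show ?thesis unfolding trans_def by (intro no_or_if) simp_all
qed

lemma aut_input_class: "input_class aut"
proof -
  have "wf_ata aut" unfolding wf_ata_def
    using trans_atoms by (auto simp: delta_aut nst_def start_def) (auto simp: aut_def nst_def split: if_splits)
  moreover have "universal_ata aut" unfolding universal_ata_def
    using trans_no_or by (auto simp: delta_aut)
  moreover have "weak_index_1_2 aut" by (auto simp: weak_index_1_2_def aut_def)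
  moreover have "uses_only_le1_gt1 aut" by (auto simp: uses_only_le1_gt1_def delta_aut)
  ultimately show ?thesis by (simp add: input_class_def)
qed

lemmas aut_class = aut_input_class[unfolded input_class_def, THEN conjunct1]
  aut_input_class[unfolded input_class_def, THEN conjunct2, THEN conjunct1]
  aut_input_class[unfolded input_class_def, THEN conjunct2, THEN conjunct2, THEN conjunct1]

lemma rank_aut: "q < nst \<Longrightarrow> rank aut q = (if q = wait then 1 else 2)"
  by (simp add: rank_def aut_def)

text \<open>The two guards are complementary and every pair of a state and a letter has an entry for
  both. So the step is deterministic, and failure is always expressed by
  \<open>BFalse\<close>.\<close>

lemma edge_Conf:
  assumes "q < nst" "fst (w k) < nlet"
  shows "edge aut w (Conf k q v) y \<longleftrightarrow>
    y = Frm k (v + tstamp w (Suc k) - tstamp w k)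
          (trans q (fst (w k)) (v + tstamp w (Suc k) - tstamp w k > 1))" (is "?l = (y = Frm k ?v ?t)")
proof
  assume ?l
  then show "y = Frm k ?v ?t"
  proof cases
    case (e_none v')
    with assms show ?thesis using delta_aut[of q "fst (w k)"]
      by (metis (full_types) linorder_not_less sat_cc.simps(3,6))
  qed (auto simp: delta_aut split: if_splits)
next
  assume y: "y = Frm k ?v ?t"
  show ?l unfolding y
    by (rule e_trans[where \<theta> = "if ?v > 1 then CAtom CmpGt 1 else CAtom CmpLe 1"])
      (use assms delta_aut in auto)
qed

lemma main_decode:
  assumes "l < L" "f < 2" "b < 2"
  shows "main l f b < nst" "\<not> main l f b < 2 * T" "main l f b \<noteq> wait" "main l f b \<noteq> start"
    "(main l f b - 2 * T) div 4 = l" "(main l f b - 2 * T) div 2 mod 2 = f" "(main l f b - 2 * T) mod 2 = b"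
proof -
  have "main l f b - 2 * T = 4 * l + 2 * f + b" by (simp add: main_def)
  moreover have "f < 2 \<Longrightarrow> b < 2 \<Longrightarrow> (4 * l + 2 * f + b) div 2 mod 2 = f"
    "f < 2 \<Longrightarrow> b < 2 \<Longrightarrow> (4 * l + 2 * f + b) mod 2 = b" by presburger+
  ultimately show "(main l f b - 2 * T) div 2 mod 2 = f" "(main l f b - 2 * T) mod 2 = b"
    using assms by simp_all
qed (use assms in \<open>auto simp: main_def nst_def wait_def start_def\<close>)

definition flag :: "nat \<Rightarrow> nat list \<Rightarrow> nat" where
  "flag l u = (if \<exists>t\<in>set u. sel l t then 1 else 0)"

lemma flag_Suc: "m < length u \<Longrightarrow> flag l (take (Suc m) u) = (if sel l (u ! m) then 1 else flag l (take m u))"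
  by (auto simp: flag_def take_Suc_conv_app_nth)

lemma flag_less: "flag l u < 2"
  by (simp add: flag_def)

definition imgs :: "nat \<Rightarrow> nat list \<Rightarrow> nat list" where
  "imgs l u = map (\<lambda>m. img l (flag l (take m u)) (u ! m)) [0..<length u]"

lemma length_imgs [simp]: "length (imgs l u) = length u"
  by (simp add: imgs_def)

lemma imgs_split:
  assumes "sel l x" "\<forall>t\<in>set v. \<not> sel l t"
  shows "imgs l (v @ x # z) = map (dft l) v @ res l # map (dft l) z"
proof (rule nth_equalityI)
  fix m assume m: "m < length (imgs l (v @ x # z))"
  consider "m < length v" | "m = length v" | k where "m = Suc (length v + k)"
    by (metis less_imp_Suc_add linorder_neqE_nat)
  then show "imgs l (v @ x # z) ! m = (map (dft l) v @ res l # map (dft l) z) ! m"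
  proof cases
    case 1
    then have "\<not> sel l (v ! m)" using assms by auto
    with 1 show ?thesis by (simp add: imgs_def img_def nth_append)
  next
    case 2
    with assms show ?thesis by (simp add: imgs_def img_def flag_def nth_append)
  next
    case 3
    then have "flag l (take m (v @ x # z)) = 1" using assms by (simp add: flag_def)
    with 3 m show ?thesis by (simp add: imgs_def img_def nth_append del: upt_Suc)
  qed
qed simp

end

section \<open>Faulty runs from accepted words\<close>

lemma count_list_card: "count_list xs y = card {i. i < length xs \<and> xs ! i = y}"
  by (simp add: count_list_eq_length_filter length_filter_conv_card eq_commute)

locale accepted_word = block_ata +
  fixes w :: "nat \<Rightarrow> nat \<times> real"
  assumes timed: "timed_word aut w" and accepted: "accepts aut w"
begin

abbreviation letter :: "nat \<Rightarrow> nat" where "letter i \<equiv> fst (w i)"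
abbreviation time :: "nat \<Rightarrow> real" where "time i \<equiv> snd (w i)"

lemma letter_less: "letter i < nlet"
  using timed by (simp add: timed_word_def)

lemma time_mono: "i < j \<Longrightarrow> time i < time j"
  using timed by (auto simp: timed_word_def intro: lift_Suc_mono_less[of "\<lambda>i. snd (w i)"])

lemma time_mono_le: "i \<le> j \<Longrightarrow> time i \<le> time j"
  using time_mono[of i j] by (cases "i = j") auto

text \<open>After event \<open>i\<close> a copy in state \<open>q\<close> whose clock was last reset at time \<open>t\<close>.\<close>
definition copy_at :: "nat \<Rightarrow> nat \<Rightarrow> real \<Rightarrow> bool" where
  "copy_at i q t \<longleftrightarrow> reach aut w (Conf (Suc i) q (time i - t))"

lemma reach_edge: "reach aut w x \<Longrightarrow> edge aut w x y \<Longrightarrow> reach aut w y"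
  unfolding reach_def by (rule rtranclp.rtrancl_into_rtrancl)

lemma reach_Conf_less: "reach aut w (Conf k q v) \<Longrightarrow> q < nst"
  using reach_legal_pos[OF _ aut_class(1,2)] by force

lemma reach_not_False: "\<not> reach aut w (Frm k v BFalse)"
  using accepts_not_lose[OF aut_class(1,2) accepted] reach_edge e_false by blast

lemma reach_And:
  "reach aut w (Frm k v (BAnd \<phi> \<psi>)) \<Longrightarrow> reach aut w (Frm k v \<phi>) \<and> reach aut w (Frm k v \<psi>)"
  using reach_edge e_and1 e_and2 by blast

lemma copy_at_step:
  assumes "copy_at i q t"
  shows "reach aut w (Frm (Suc i) (time (Suc i) - t) (trans q (letter (Suc i)) (time (Suc i) - t > 1)))"
proof -
  have q: "q < nst" using assms reach_Conf_less unfolding copy_at_def by blast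
  have "edge aut w (Conf (Suc i) q (time i - t)) (Frm (Suc i) (time (Suc i) - t)
     (trans q (letter (Suc i)) (time (Suc i) - t > 1)))"
    unfolding edge_Conf[of q w "Suc i", OF q letter_less] by (simp add: tstamp_def)
  with assms show ?thesis unfolding copy_at_def by (rule reach_edge)
qed

lemma copy_at_atom:
  assumes "reach aut w (Frm i (time i - t) (BAtom q f))"
  shows "copy_at i q (if f = Reset then time i else t)"
  unfolding copy_at_def using reach_edge[OF assms e_atom] by (cases f) auto

lemma item_copy_step:
  assumes "copy_at i q t" "q < 2 * T"
  shows "(time (Suc i) \<le> t + 1 \<longrightarrow> copy_at (Suc i) q t) \<and>
    (time (Suc i) > t + 1 \<longrightarrow> letter (Suc i) = q)"
proof -
  note * = copy_at_step[OF assms(1)]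
  show ?thesis
  proof (cases "time (Suc i) > t + 1")
    case True
    then show ?thesis using * assms(2) reach_not_False by (auto simp: trans_def split: if_splits)
  next
    case False
    then have "reach aut w (Frm (Suc i) (time (Suc i) - t) (BAtom q Nop))"
      using * assms(2) by (simp add: trans_def)
    from copy_at_atom[OF this] False show ?thesis by simp
  qed
qed

lemma item_copy_checks:
  assumes "copy_at i q (time i)" "q < 2 * T" "i < j" "time i + 1 < time j"
    and "\<And>m. m < j \<Longrightarrow> time m \<le> time i + 1"
  shows "letter j = q"
proof -
  have "i + m < j \<Longrightarrow> copy_at (i + m) q (time i)" for m
  proof (induction m)
    case (Suc m)
    with assms(5)[of "Suc (i + m)"] item_copy_step[of "i + m" q "time i"] assms(2) show ?case by simp
  qed (use assms(1) in simp)
  from this[of "j - 1 - i"] assms(3) have "copy_at (j - 1) q (time i)" by simp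
  from item_copy_step[OF this assms(2)] assms(3,4) show ?thesis by simp
qed

text \<open>Otherwise the copy would loop in \<open>wait\<close> forever, a play through rank 1 that
  never reaches \<open>WinSink\<close>.\<close>

lemma wait_copy:
  assumes "copy_at i wait t"
  shows "\<exists>j>i. letter j = 2 * T"
proof (rule ccontr)
  assume neg: "\<not> (\<exists>j>i. letter j = 2 * T)"
  \<comment> \<open>Each letter takes two positions, a configuration and an atom, hence
    \<open>n div 2\<close>.\<close>
  define s where "s n = (if even n then Conf (Suc i + n div 2) wait (time (i + n div 2) - t)
    else Frm (Suc i + n div 2) (time (Suc (i + n div 2)) - t) (BAtom wait Nop))" for n
  have ws: "wait < nst" by (simp add: wait_def nst_def)
  have tr: "trans wait (letter (Suc (i + k))) late = BAtom wait Nop" for k late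
    using neg by (auto simp: trans_def wait_def)
  have "edge aut w (s n) (s (Suc n))" for n
  proof (cases "even n")
    case True
    then show ?thesis
      using edge_Conf[of wait w "Suc (i + n div 2)", OF ws letter_less] tr
      by (simp add: s_def tstamp_def)
  next
    case False
    then have "Suc n div 2 = Suc (n div 2)" by presburger
    then show ?thesis using False e_atom[of aut w "Suc i + n div 2" _ wait Nop] by (simp add: s_def)
  qed
  then have "path aut w s" by (simp add: path_def)
  moreover have "reach aut w (s 0)" using assms by (simp add: s_def copy_at_def)
  moreover have "s 0 = Conf (Suc i) wait (time i - t)" by (simp add: s_def)
  ultimately have "\<exists>n. s n = WinSink"
    using accepts_rank_one_wins[OF aut_class accepted] rank_aut[OF ws] by simp
  then show False by (auto simp: s_def split: if_splits)
qed

text \<open>Every failed test of \<open>trans\<close> leads to \<open>BFalse\<close>, which is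
  unreachable; so the letter passes all of them, as an item or as a control letter.\<close>

lemma main_copy_step:
  assumes "copy_at i (main l f b) t" "l < L" "f < 2" "b < 2"
  shows "letter (Suc i) < 2 * T \<and> time (Suc i) \<le> t + 1 \<and> letter (Suc i) mod 2 = b \<and>
      \<not> forb l (letter (Suc i) div 2) \<and>
      copy_at (Suc i) (main l (if sel l (letter (Suc i) div 2) then 1 else f) (1 - b)) t \<and>
      copy_at (Suc i) (2 * img l f (letter (Suc i) div 2) + par l b) (time (Suc i))
    \<or> 2 * T \<le> letter (Suc i) \<and> time (Suc i) > t + 1 \<and> f = 1 \<and> nxt l (letter (Suc i) - 2 * T) \<and>
      copy_at (Suc i) (main (letter (Suc i) - 2 * T) 0 0) (time (Suc i)) \<and> copy_at (Suc i) wait t"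
proof -
  note d = main_decode[OF assms(2-4)]
  note * = copy_at_step[OF assms(1)]
  let ?a = "letter (Suc i)" and ?v = "time (Suc i) - t"
  show ?thesis
  proof (cases "?a < 2 * T")
    case True
    have ok: "\<not> ?v > 1 \<and> ?a mod 2 = b \<and> \<not> forb l (?a div 2)"
    proof (rule ccontr)
      assume "\<not> (\<not> ?v > 1 \<and> ?a mod 2 = b \<and> \<not> forb l (?a div 2))"
      then have "trans (main l f b) ?a (?v > 1) = BFalse" using True d by (auto simp: trans_def)
      with * reach_not_False show False by metis
    qed
    then have "trans (main l f b) ?a (?v > 1) =
       BAnd (BAtom (main l (if sel l (?a div 2) then 1 else f) (1 - b)) Nop)
         (BAtom (2 * img l f (?a div 2) + par l b) Reset)"
      using True d by (simp add: trans_def)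
    with * have "reach aut w (Frm (Suc i) ?v (BAtom (main l (if sel l (?a div 2) then 1 else f) (1 - b)) Nop))"
      "reach aut w (Frm (Suc i) ?v (BAtom (2 * img l f (?a div 2) + par l b) Reset))"
      using reach_And by metis+
    from this[THEN copy_at_atom] True ok show ?thesis by auto
  next
    case False
    have ok: "?v > 1 \<and> f = 1 \<and> nxt l (?a - 2 * T)"
    proof (rule ccontr)
      assume "\<not> (?v > 1 \<and> f = 1 \<and> nxt l (?a - 2 * T))"
      then have "trans (main l f b) ?a (?v > 1) = BFalse" using False d by (auto simp: trans_def)
      with * reach_not_False show False by metis
    qed
    then have "trans (main l f b) ?a (?v > 1) = BAnd (BAtom (main (?a - 2 * T) 0 0) Reset) (BAtom wait Nop)"
      using False d by (simp add: trans_def)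
    with * have "reach aut w (Frm (Suc i) ?v (BAtom (main (?a - 2 * T) 0 0) Reset))"
      "reach aut w (Frm (Suc i) ?v (BAtom wait Nop))"
      using reach_And by metis+
    from this[THEN copy_at_atom] False ok show ?thesis by auto
  qed
qed

section \<open>Control events and the blocks between them\<close>

definition control :: "nat \<Rightarrow> bool" where
  "control c \<longleftrightarrow> 2 * T \<le> letter c \<and> copy_at c (main (letter c - 2 * T) 0 0) (time c) \<and>
     (\<exists>t. copy_at c wait t)"

lemma control_initial: "control 0 \<and> letter 0 = 2 * T"
proof -
  have st: "start < nst" by (simp add: start_def nst_def)
  have "reach aut w (Conf 0 start 0)" by (simp add: reach_def)
  moreover have "edge aut w (Conf 0 start 0) (Frm 0 (time 0) (trans start (letter 0) (time 0 > 1)))"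
    unfolding edge_Conf[of start w 0, OF st letter_less] by (simp add: tstamp_def)
  ultimately have r: "reach aut w (Frm 0 (time 0 - 0) (trans start (letter 0) (time 0 > 1)))"
    by (auto intro: reach_edge)
  then have l: "letter 0 = 2 * T"
    using reach_not_False by (auto simp: trans_def start_def wait_def split: if_splits)
  then have "trans start (letter 0) (time 0 > 1) = BAnd (BAtom (main 0 0 0) Reset) (BAtom wait Nop)"
    by (simp add: trans_def start_def wait_def)
  with r have "reach aut w (Frm 0 (time 0 - 0) (BAtom (main 0 0 0) Reset))"
    "reach aut w (Frm 0 (time 0 - 0) (BAtom wait Nop))" using reach_And by metis+
  from this[THEN copy_at_atom] l show ?thesis by (auto simp: control_def)
qed

definition next_control :: "nat \<Rightarrow> nat" where
  "next_control c = (LEAST j. c < j \<and> 2 * T \<le> letter j)"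

definition items :: "nat \<Rightarrow> nat list" where
  "items c = map (\<lambda>i. letter i div 2) [Suc c..<next_control c]"

lemma length_items: "length (items c) = next_control c - Suc c"
  by (simp add: items_def)

lemma nth_items: "m < length (items c) \<Longrightarrow> items c ! m = letter (Suc (c + m)) div 2"
  by (simp add: items_def)

text \<open>Existence comes from the \<open>wait\<close> copy that accompanies each control event:
  the letter \<open>2 * T\<close> that it must see is a control letter.\<close>

lemma next_control:
  assumes "control c"
  shows "c < next_control c" "2 * T \<le> letter (next_control c)"
    "\<And>i. c < i \<Longrightarrow> i < next_control c \<Longrightarrow> letter i < 2 * T"
proof -
  from assms obtain j where "c < j \<and> 2 * T \<le> letter j" using wait_copy unfolding control_def by force
  then have "c < next_control c \<and> 2 * T \<le> letter (next_control c)"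
    unfolding next_control_def by (rule LeastI)
  then show "c < next_control c" "2 * T \<le> letter (next_control c)" by auto
  show "letter i < 2 * T" if "c < i" "i < next_control c" for i
    using not_less_Least[OF that(2)[unfolded next_control_def]] that(1) by auto
qed

lemma control_less: "control c \<Longrightarrow> letter c - 2 * T < L"
  using letter_less[of c] unfolding nlet_def control_def by linarith

lemma block_main:
  assumes c: "control c" and m: "m \<le> length (items c)"
  shows "copy_at (c + m) (main (letter c - 2 * T) (flag (letter c - 2 * T) (take m (items c))) (m mod 2)) (time c)"
  using m
proof (induction m)
  case 0
  then show ?case using c by (simp add: control_def flag_def)
next
  case (Suc m)
  then have "letter (Suc (c + m)) < 2 * T"
    using next_control(3)[OF c, of "Suc (c + m)"] by (simp add: length_items)
  with main_copy_step[OF Suc.IH control_less[OF c] flag_less] Suc.prems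
  have "copy_at (Suc (c + m)) (main (letter c - 2 * T) (if sel (letter c - 2 * T) (letter (Suc (c + m)) div 2) then 1
     else flag (letter c - 2 * T) (take m (items c))) (1 - m mod 2)) (time c)" by auto
  moreover have "1 - m mod 2 = Suc m mod 2" by presburger
  ultimately show ?case using Suc.prems by (simp add: flag_Suc nth_items)
qed

lemma block_item:
  assumes c: "control c" and m: "m < length (items c)"
  shows "letter (Suc (c + m)) < 2 * T" "time (Suc (c + m)) \<le> time c + 1"
    "letter (Suc (c + m)) mod 2 = m mod 2" "\<not> forb (letter c - 2 * T) (items c ! m)"
    "copy_at (Suc (c + m)) (2 * imgs (letter c - 2 * T) (items c) ! m + par (letter c - 2 * T) (m mod 2))
       (time (Suc (c + m)))"
proof -
  from m show lt: "letter (Suc (c + m)) < 2 * T"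
    using next_control(3)[OF c, of "Suc (c + m)"] by (simp add: length_items)
  note * = main_copy_step[OF block_main[OF c, of m] control_less[OF c] flag_less]
  from * lt m show "time (Suc (c + m)) \<le> time c + 1"
    "letter (Suc (c + m)) mod 2 = m mod 2" "\<not> forb (letter c - 2 * T) (items c ! m)"
    "copy_at (Suc (c + m)) (2 * imgs (letter c - 2 * T) (items c) ! m + par (letter c - 2 * T) (m mod 2))
       (time (Suc (c + m)))"
    by (auto simp: nth_items imgs_def)
qed

lemma block_end:
  assumes c: "control c"
  shows "control (next_control c)" "time (next_control c) > time c + 1"
    "nxt (letter c - 2 * T) (letter (next_control c) - 2 * T)"
    "\<exists>t\<in>set (items c). sel (letter c - 2 * T) t"
proof -
  let ?m = "length (items c)"
  have e: "Suc (c + ?m) = next_control c" using next_control(1)[OF c] by (simp add: length_items)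
  have "2 * T \<le> letter (Suc (c + ?m))" using next_control(2)[OF c] e by simp
  with main_copy_step[OF block_main[OF c order_refl] control_less[OF c] flag_less]
  show "control (next_control c)" "time (next_control c) > time c + 1"
    "nxt (letter c - 2 * T) (letter (next_control c) - 2 * T)"
    "\<exists>t\<in>set (items c). sel (letter c - 2 * T) t"
    unfolding e[symmetric] control_def by (auto simp: flag_def split: if_splits)
qed

lemma imgs_less: "set u \<subseteq> {..<T} \<Longrightarrow> m < length u \<Longrightarrow> imgs l u ! m < T"
  using res_less dft_less by (auto simp: imgs_def img_def subset_iff)

lemma items_less:
  assumes "control c"
  shows "set (items c) \<subseteq> {..<T}"
proof
  fix x assume "x \<in> set (items c)"
  then obtain m where m: "m < length (items c)" "x = items c ! m" by (metis in_set_conv_nth)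
  then show "x \<in> {..<T}" using block_item(1)[OF assms m(1)] by (simp add: nth_items less_mult_imp_div_less)
qed

section \<open>Images of items in the next block\<close>

definition succ_event :: "nat \<Rightarrow> nat" where
  "succ_event i = (LEAST j. time j > time i + 1)"

text \<open>The image is later than \<open>time c + 1\<close>, and no item of block \<open>c\<close>
  is that late. The control letter after \<open>d\<close> is more than one unit later than
  \<open>d\<close>, hence than the item, so the image does not lie beyond it. Being an item letter,
  the image is neither of the two control letters.\<close>

lemma succ_event_item:
  assumes c: "control c" and m: "m < length (items c)"
  defines "d \<equiv> next_control c" and "i \<equiv> Suc (c + m)"
  shows "d < succ_event i" "succ_event i < next_control d"
    "letter (succ_event i) = 2 * imgs (letter c - 2 * T) (items c) ! m + par (letter c - 2 * T) (m mod 2)"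
proof -
  let ?q = "2 * imgs (letter c - 2 * T) (items c) ! m + par (letter c - 2 * T) (m mod 2)"
  have q: "?q < 2 * T"
  proof -
    have "par (letter c - 2 * T) (m mod 2) < 2" by (auto simp: par_def)
    with imgs_less[OF items_less[OF c] m, of "letter c - 2 * T"] show ?thesis by linarith
  qed
  have i: "c < i" "i < d" using m next_control(1)[OF c] by (auto simp: i_def d_def length_items)
  have dd: "control d" "time d > time c + 1" using block_end[OF c] by (auto simp: d_def)
  have e: "time (next_control d) > time d + 1" "control (next_control d)" using block_end[OF dd(1)] by auto
  have ex: "time (next_control d) > time i + 1" using e(1) time_mono[OF i(2)] by simp
  then have l: "time (succ_event i) > time i + 1" and le: "succ_event i \<le> next_control d"
    unfolding succ_event_def by (rule LeastI, rule Least_le)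
  have min: "time j \<le> time i + 1" if "j < succ_event i" for j
    using not_less_Least[OF that[unfolded succ_event_def]] by auto
  have gt: "i < succ_event i" using l time_mono_le[of "succ_event i" i] by linarith
  show letter: "letter (succ_event i) = ?q"
    by (rule item_copy_checks[OF _ q gt l min]) (use block_item(5)[OF c m] in \<open>auto simp: i_def\<close>)
  have "letter (succ_event i) < 2 * T" using letter q by simp
  then have ne: "succ_event i \<noteq> d" "succ_event i \<noteq> next_control d"
    using dd(1) e(2) by (auto simp: control_def)
  have "\<not> succ_event i < d"
  proof
    assume h: "succ_event i < d"
    then have "succ_event i = Suc (c + (succ_event i - Suc c))" "succ_event i - Suc c < length (items c)"
      using gt i by (auto simp: length_items d_def)
    then have "time (succ_event i) \<le> time c + 1" using block_item(2)[OF c] by metis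
    with l time_mono[OF i(1)] show False by simp
  qed
  with ne le show "d < succ_event i" "succ_event i < next_control d" by auto
qed

text \<open>Images of neighbouring items have different parities, flipped or not, so they are
  different events; their order follows from the order of time.\<close>

lemma succ_event_strict:
  assumes c: "control c" and "m < n" "n < length (items c)"
  shows "succ_event (Suc (c + m)) < succ_event (Suc (c + n))"
  using assms(2,3)
proof (induction n)
  case (Suc n)
  let ?f = "\<lambda>m. succ_event (Suc (c + m))"
  have "?f n \<noteq> ?f (Suc n)"
  proof
    assume "?f n = ?f (Suc n)"
    with succ_event_item(3)[OF c, of n] succ_event_item(3)[OF c Suc.prems(2)] Suc.prems
    have "(2 * imgs (letter c - 2 * T) (items c) ! n + par (letter c - 2 * T) (n mod 2)) mod 2
        = (2 * imgs (letter c - 2 * T) (items c) ! Suc n + par (letter c - 2 * T) (Suc n mod 2)) mod 2" by simp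
    then show False unfolding par_def by (auto simp: mod_Suc split: if_splits)
  qed
  moreover have "?f n \<le> ?f (Suc n)"
  proof -
    have t: "time (succ_event (Suc (c + Suc n))) > time (Suc (c + Suc n)) + 1"
    proof -
      have "control (next_control c)" using block_end[OF c] by auto
      then have "time (next_control (next_control c)) > time (next_control c) + 1" using block_end by auto
      moreover have "Suc (c + Suc n) < next_control c" using Suc.prems by (auto simp: length_items)
      ultimately have "time (next_control (next_control c)) > time (Suc (c + Suc n)) + 1"
        using time_mono by (meson add_strict_right_mono less_trans)
      then show ?thesis unfolding succ_event_def by (rule LeastI)
    qed
    moreover have "time (Suc (c + n)) < time (Suc (c + Suc n))" by (rule time_mono) simp
    ultimately have "time (succ_event (Suc (c + Suc n))) > time (Suc (c + n)) + 1" by simp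
    then show ?thesis unfolding succ_event_def[of "Suc (c + n)"] by (rule Least_le)
  qed
  ultimately have "?f n < ?f (Suc n)" by simp
  with Suc show ?case by (cases "m = n") auto
qed simp

text \<open>Taking images is an injection into the next block; items outside its range are the
  insertion errors. After control letter 0 the first image has parity 1 whereas a block starts with
  parity 0, so the first position is always outside the range.\<close>

lemma block_embeds:
  assumes c: "control c"
  shows "count_list (imgs (letter c - 2 * T) (items c)) y \<le> count_list (items (next_control c)) y"
    and "letter c = 2 * T \<Longrightarrow> length (items c) < length (items (next_control c))"
proof -
  let ?d = "next_control c" and ?l = "letter c - 2 * T"
  define g where "g m = succ_event (Suc (c + m)) - Suc ?d" for m
  have g: "g m < length (items ?d)" "Suc (?d + g m) = succ_event (Suc (c + m))"
     "items ?d ! g m = imgs ?l (items c) ! m" if "m < length (items c)" for m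
  proof -
    from succ_event_item[OF c that] show 1: "g m < length (items ?d)" "Suc (?d + g m) = succ_event (Suc (c + m))"
      by (auto simp: g_def length_items)
    have "par ?l (m mod 2) < 2" by (auto simp: par_def)
    then show "items ?d ! g m = imgs ?l (items c) ! m"
      using succ_event_item(3)[OF c that] 1 by (simp add: nth_items)
  qed
  have strict: "g m < g n" if "m < n" "n < length (items c)" for m n
  proof -
    have "m < length (items c)" using that by simp
    with succ_event_strict[OF c that] g(2)[OF that(2)] g(2)[of m] show ?thesis by linarith
  qed
  have inj: "inj_on g {..<length (items c)}"
    by (rule inj_onI) (metis lessThan_iff linorder_neqE_nat nat_neq_iff strict)
  show "count_list (imgs ?l (items c)) y \<le> count_list (items ?d) y"
    unfolding count_list_card
    by (rule card_inj_on_le[of g]) (use g in \<open>auto intro: inj_on_subset[OF inj]\<close>)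
  show "length (items c) < length (items ?d)" if E: "letter c = 2 * T"
  proof -
    have "items c \<noteq> []" using block_end(4)[OF c] by auto
    then have pos: "0 < length (items c)" by simp
    have "g 0 \<noteq> 0"
    proof
      assume "g 0 = 0"
      then have s: "succ_event (Suc c) = Suc ?d" using g(2)[OF pos] by simp
      have "letter (Suc ?d) mod 2 = 0"
        using block_item(3)[OF block_end(1)[OF c], of 0] g(1)[OF pos] by (cases "items ?d") auto
      moreover have "letter (Suc ?d) mod 2 = 1"
        using succ_event_item(3)[OF c pos] E by (simp add: s par_def)
      ultimately show False by simp
    qed
    then have g0: "0 < g 0" by simp
    have "0 < g m" if "m < length (items c)" for m
      by (cases "m = 0") (use g0 strict[of 0 m] that in auto)
    then have "g ` {..<length (items c)} \<subseteq> {1..<length (items ?d)}"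
      using g(1) by (auto simp: Suc_le_eq)
    from card_mono[OF _ this] have "card (g ` {..<length (items c)}) \<le> length (items ?d) - 1"
      by simp
    then have "length (items c) \<le> length (items ?d) - 1" using inj by (simp add: card_image)
    then show ?thesis using pos by linarith
  qed
qed

end

context block_ata begin

text \<open>What remains of an accepted word when times and the order of the images are forgotten:
  the images form a sub-multiset of the next block.\<close>

definition faulty_run :: "(nat \<Rightarrow> nat) \<Rightarrow> (nat \<Rightarrow> nat list) \<Rightarrow> bool" where
  "faulty_run ctl u \<longleftrightarrow> ctl 0 = 0 \<and> (\<forall>k. \<exists>j>k. ctl j = 0) \<and>
     (\<forall>k. ctl k < L \<and> nxt (ctl k) (ctl (Suc k)) \<and>
        set (u k) \<subseteq> {..<T} \<and> (\<exists>t\<in>set (u k). sel (ctl k) t) \<and> (\<forall>t\<in>set (u k). \<not> forb (ctl k) t) \<and>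
        (\<forall>y. count_list (imgs (ctl k) (u k)) y \<le> count_list (u (Suc k)) y) \<and>
        (ctl k = 0 \<longrightarrow> length (u k) < length (u (Suc k))))"

lemma accepts_faulty_run:
  assumes "timed_word aut w" "accepts aut w"
  shows "\<exists>ctl u. faulty_run ctl u"
proof -
  interpret accepted_word T L sel forb res dft nxt w
    by unfold_locales (use assms in auto)
  define c where "c k = (next_control ^^ k) 0" for k
  have ctl: "control (c k)" for k
    by (induction k) (use control_initial block_end(1) in \<open>auto simp: c_def\<close>)
  have cSuc: "c (Suc k) = next_control (c k)" for k by (simp add: c_def)
  have mono: "c k < c (Suc k)" for k using next_control(1)[OF ctl] by (simp add: cSuc)
  \<comment> \<open>This turns the letter \<open>2 * T\<close> promised by a \<open>wait\<close>
    copy into a block of the enumeration.\<close>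
  have onto: "\<exists>k. j = c k" if "2 * T \<le> letter j" for j
  proof -
    have "\<exists>k. c k \<le> j \<and> j < c (Suc k)"
    proof -
      have sm: "k \<le> c k" for k by (induction k) (use mono in \<open>auto simp: less_le_trans Suc_le_eq intro: le_less_trans\<close>)
      define k where "k = (LEAST k. j < c (Suc k))"
      have "j < c (Suc j)" using sm[of "Suc j"] by simp
      then have 1: "j < c (Suc k)" unfolding k_def by (rule LeastI)
      have "c k \<le> j"
      proof (cases k)
        case 0
        then show ?thesis by (simp add: c_def)
      next
        case (Suc k')
        then show ?thesis using not_less_Least[of k' "\<lambda>k. j < c (Suc k)"] by (simp add: k_def)
      qed
      with 1 show ?thesis by blast
    qed
    then obtain k where "c k \<le> j" "j < next_control (c k)" by (auto simp: cSuc)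
    with next_control(3)[OF ctl, of k j] that show ?thesis by (metis le_neq_implies_less not_less)
  qed
  have "\<exists>j>k. letter (c j) - 2 * T = 0" for k
  proof -
    obtain i where i: "i > c k" "letter i = 2 * T" using wait_copy ctl[of k] unfolding control_def by blast
    then obtain j where "i = c j" using onto by force
    moreover have "strict_mono c" using mono by (rule strict_mono_Suc_iff[THEN iffD2, rule_format])
    ultimately show ?thesis using i by (auto simp: strict_mono_less)
  qed
  moreover have "letter (c k) = 2 * T" if "letter (c k) - 2 * T = 0" for k
    using that ctl[of k] by (simp add: control_def)
  ultimately have "faulty_run (\<lambda>k. letter (c k) - 2 * T) (\<lambda>k. items (c k))"
    unfolding faulty_run_def cSuc
    using ctl control_less block_end block_embeds items_less block_item(4) control_initial
    by (auto simp: c_def in_set_conv_nth)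
  then show ?thesis by blast
qed

end

section \<open>Accepted words from perfect runs\<close>

text \<open>The additional item is put in front: the old items keep their distance to the right end,
  and their shift by one position produces exactly the parity flip of control letter 0.\<close>

locale perfect_run = block_ata +
  fixes ctl :: "nat \<Rightarrow> nat" and u :: "nat \<Rightarrow> nat list"
  assumes ctl_0: "ctl 0 = 0" and ctl_inf: "\<exists>j>k. ctl j = 0"
    and ctl_less: "ctl k < L" and ctl_nxt: "nxt (ctl k) (ctl (Suc k))"
    and u_less: "set (u k) \<subseteq> {..<T}"
    and u_sel: "\<exists>t\<in>set (u k). sel (ctl k) t" and u_forb: "t \<in> set (u k) \<Longrightarrow> \<not> forb (ctl k) t"
    and u_Suc: "u (Suc k) = (if ctl k = 0 then [0] else []) @ imgs (ctl k) (u k)"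
    and len_u_0: "length (u 0) = 1"
begin

abbreviation n :: "nat \<Rightarrow> nat" where "n k \<equiv> length (u k)"

lemma n_Suc: "n (Suc k) = (if ctl k = 0 then Suc (n k) else n k)"
  by (simp add: u_Suc)

lemma n_le: "n k \<le> Suc k"
  by (induction k) (use len_u_0 in \<open>auto simp: n_Suc\<close>)

definition succ_place :: "nat \<times> nat \<Rightarrow> nat \<times> nat" where
  "succ_place = (\<lambda>(k, p). if p < n k then (k, Suc p) else (Suc k, 0))"

text \<open>Event \<open>i\<close> sits at position \<open>p\<close> of block \<open>k\<close>, where position 0 is the control letter.\<close>
definition place :: "nat \<Rightarrow> nat \<times> nat" where
  "place i = (succ_place ^^ i) (0, 0)"

text \<open>An item keeps its distance to the right end of the block, hence its offset, throughout the run.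
  The drift \<open>1 - 1 / (k + 2)\<close> makes the copy of an item appear just later than one time unit,
  but not later than one time unit after the next item.\<close>
definition offset :: "nat \<Rightarrow> nat \<Rightarrow> real" where
  "offset k p = (if p = 0 then 0 else 1 / (real (n k - p) + 2))"

definition stamp :: "nat \<times> nat \<Rightarrow> real" where
  "stamp = (\<lambda>(k, p). real k + 1 - 1 / (real k + 2) + offset k p)"

definition symbol :: "nat \<times> nat \<Rightarrow> nat" where
  "symbol = (\<lambda>(k, p). if p = 0 then 2 * T + ctl k else 2 * (u k ! (p - 1)) + (p - 1) mod 2)"

definition word :: "nat \<Rightarrow> nat \<times> real" where
  "word i = (symbol (place i), stamp (place i))"

lemma place_Suc: "place (Suc i) = succ_place (place i)"
  by (simp add: place_def)

lemma place_valid: "place i = (k, p) \<Longrightarrow> p \<le> n k"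
proof (induction i arbitrary: k p)
  case (Suc i)
  then show ?case by (cases "place i") (auto simp: place_Suc succ_place_def split: if_splits)
qed (auto simp: place_def)

lemma place_le: "fst (place i) \<le> i"
proof (induction i)
  case (Suc i)
  then show ?case by (cases "place i") (auto simp: place_Suc succ_place_def split: if_splits)
qed (auto simp: place_def)

lemma place_onto: "p \<le> n k \<Longrightarrow> \<exists>i. place i = (k, p)"
proof (induction k arbitrary: p)
  case 0
  then show ?case
  proof (induction p)
    case 0
    show ?case by (rule exI[of _ 0]) (simp add: place_def)
  next
    case (Suc p)
    then obtain i where "place i = (0, p)" by auto
    with Suc.prems show ?case by (intro exI[of _ "Suc i"]) (simp add: place_Suc succ_place_def)
  qed
next
  case (Suc k)
  from Suc.IH[of "n k"] obtain i where i: "place i = (k, n k)" by auto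
  from Suc.prems show ?case
  proof (induction p)
    case 0
    show ?case by (rule exI[of _ "Suc i"]) (simp add: place_Suc succ_place_def i)
  next
    case (Suc p)
    then obtain i where "place i = (Suc k, p)" by auto
    with Suc.prems show ?case by (intro exI[of _ "Suc i"]) (simp add: place_Suc succ_place_def)
  qed
qed

lemma offset_bounds: "0 \<le> offset k p" "offset k p \<le> 1 / 2"
  by (auto simp: offset_def field_simps)

lemma drift_pos: "1 / (real k + 3) < 1 / (real k + 2)"
  by (simp add: field_simps)

lemma drift_le:
  assumes "m \<le> k"
  shows "1 / (real k + 2) - 1 / (real k + 3) \<le> 1 / (real m + 2) - 1 / (real m + 3)"
proof -
  have "1 / (real j + 2) - 1 / (real j + 3) = 1 / ((real j + 2) * (real j + 3))" for j
    by (simp add: field_simps)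
  moreover have "1 / ((real k + 2) * (real k + 3)) \<le> 1 / ((real m + 2) * (real m + 3))"
    using assms by (intro divide_left_mono mult_mono) auto
  ultimately show ?thesis by simp
qed

lemma stamp_Suc_0: "stamp (Suc k, 0) = stamp (k, 0) + 1 + (1 / (real k + 2) - 1 / (real k + 3))"
  by (simp add: stamp_def offset_def add.commute)

lemma stamp_offset: "stamp (k, p) = stamp (k, 0) + offset k p"
  by (simp add: stamp_def offset_def)

lemma stamp_mono_step: "p \<le> n k \<Longrightarrow> stamp (k, p) < stamp (succ_place (k, p))"
proof (cases "p < n k")
  case True
  have "offset k p < offset k (Suc p)"
  proof (cases "p = 0")
    case False
    from True have "real (n k - p) = real (n k - Suc p) + 1" by simp
    with False show ?thesis by (simp add: offset_def field_simps)
  qed (simp add: offset_def)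
  with True show ?thesis by (simp add: succ_place_def stamp_offset[of k p] stamp_offset[of k "Suc p"])
next
  case False
  with stamp_Suc_0[of k] stamp_offset[of k p] offset_bounds[of k p] drift_pos[of k] show ?thesis
    by (simp add: succ_place_def)
qed

lemma word_Suc: "snd (word i) < snd (word (Suc i))"
proof -
  obtain k p where kp: "place i = (k, p)" by force
  with stamp_mono_step[OF place_valid[OF kp]] show ?thesis by (simp add: word_def place_Suc)
qed

lemma word_mono: "i < j \<Longrightarrow> snd (word i) < snd (word j)"
  using word_Suc by (rule lift_Suc_mono_less)

lemma word_mono_iff: "snd (word i) < snd (word j) \<longleftrightarrow> i < j"
  using word_mono by (metis linorder_neqE_nat not_less_iff_gr_or_eq)

lemma word_letter: "fst (word i) < nlet"
proof -
  obtain k p where kp: "place i = (k, p)" by force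
  have p: "p \<le> n k" using place_valid[OF kp] .
  show ?thesis
  proof (cases "p = 0")
    case True
    then show ?thesis using ctl_less[of k] by (simp add: word_def kp symbol_def nlet_def)
  next
    case False
    then have "u k ! (p - 1) < T" using u_less[of k] p by (simp add: subset_iff)
    then show ?thesis using False by (simp add: word_def kp symbol_def nlet_def)
  qed
qed

lemma word_timed: "timed_word aut word"
  using word_letter word_Suc by (auto simp: timed_word_def word_def place_def stamp_def offset_def)

lemma word_non_zeno: "non_zeno word"
  unfolding non_zeno_def
proof
  fix x :: real
  obtain k :: nat where k: "x < real k" using reals_Archimedean2 by blast
  obtain i where "place i = (k, 0)" using place_onto[of 0 k] by auto
  moreover have "1 / (real k + 2) \<le> 1" by (simp add: field_simps)
  ultimately have "real k \<le> snd (word i)" by (simp add: word_def stamp_def offset_def)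
  with k show "\<exists>i. x < snd (word i)" by (intro exI[of _ i]) simp
qed

definition shift :: "nat \<Rightarrow> nat \<Rightarrow> nat" where
  "shift k p = (if ctl k = 0 then Suc p else p)"

lemma symbol_image:
  assumes "p < n k"
  shows "symbol (Suc k, Suc (shift k p)) = 2 * imgs (ctl k) (u k) ! p + par (ctl k) (p mod 2)"
proof -
  have "Suc p mod 2 = 1 - p mod 2" by presburger
  then show ?thesis by (simp add: symbol_def shift_def u_Suc par_def)
qed

text \<open>Let \<open>m\<close> items lie to the right. The copy is late by the drift
  \<open>1/(k+2) - 1/(k+3)\<close>, while the event before it in the next block is at least
  \<open>1/(m+2) - 1/(m+3)\<close> earlier. Since block \<open>k\<close> has at most
  \<open>k + 1\<close> items, \<open>m \<le> k\<close> and the drift fits into this gap.\<close>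

lemma stamp_image:
  assumes "p < n k"
  shows "stamp (k, Suc p) + 1 < stamp (Suc k, Suc (shift k p))"
    and "stamp (Suc k, shift k p) \<le> stamp (k, Suc p) + 1"
proof -
  define m where "m = n k - Suc p"
  have off: "offset k (Suc p) = 1 / (real m + 2)" "offset (Suc k) (Suc (shift k p)) = 1 / (real m + 2)"
    by (auto simp: offset_def shift_def n_Suc m_def)
  show "stamp (k, Suc p) + 1 < stamp (Suc k, Suc (shift k p))"
    using stamp_offset[of k "Suc p"] stamp_offset[of "Suc k" "Suc (shift k p)"] off stamp_Suc_0[of k] drift_pos[of k]
    by simp
  have mk: "m \<le> k" using n_le[of k] by (simp add: m_def)
  have "offset (Suc k) (shift k p) \<le> 1 / (real m + 3)"
  proof (cases "shift k p = 0")
    case False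
    have "n (Suc k) - shift k p = Suc m" using assms by (auto simp: shift_def n_Suc m_def)
    with False show ?thesis by (simp add: offset_def add.commute)
  qed (simp add: offset_def)
  then show "stamp (Suc k, shift k p) \<le> stamp (k, Suc p) + 1"
    using stamp_offset[of k "Suc p"] stamp_offset[of "Suc k" "shift k p"] off stamp_Suc_0[of k] drift_le[OF mk]
    by simp
qed

lemma image_event:
  assumes p: "p < n k" and i: "snd (word i) \<le> stamp (k, Suc p) + 1" "stamp (k, Suc p) + 1 < snd (word (Suc i))"
  shows "fst (word (Suc i)) = 2 * imgs (ctl k) (u k) ! p + par (ctl k) (p mod 2)"
proof -
  have sh: "shift k p < n (Suc k)" using p by (simp add: shift_def n_Suc)
  then obtain j where j: "place j = (Suc k, shift k p)" using place_onto[of "shift k p" "Suc k"] by auto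
  then have j': "place (Suc j) = (Suc k, Suc (shift k p))" using sh by (simp add: place_Suc succ_place_def)
  have "snd (word j) < snd (word (Suc i))" "snd (word i) < snd (word (Suc j))"
    using stamp_image[OF p] i j j' by (auto simp: word_def)
  then have "j = i" by (simp add: word_mono_iff)
  then show ?thesis using j' symbol_image[OF p] by (simp add: word_def)
qed

text \<open>An inductive invariant that excludes \<open>LoseSink\<close>. The scanner's clock dates
  from the control letter of its block; an item copy is included only while its check is still
  due.\<close>

definition good_conf :: "nat \<Rightarrow> nat \<Rightarrow> real \<Rightarrow> bool" where
  "good_conf K q v \<longleftrightarrow> K = 0 \<and> q = start \<and> v = 0 \<or>
     (\<exists>i. K = Suc i \<and> (q = wait \<or>
        (\<exists>k p. place i = (k, p) \<and> q = main (ctl k) (flag (ctl k) (take p (u k))) (p mod 2) \<and>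
           v = stamp (k, p) - stamp (k, 0)) \<or>
        (\<exists>k p. p < n k \<and> q = 2 * imgs (ctl k) (u k) ! p + par (ctl k) (p mod 2) \<and>
           v = snd (word i) - stamp (k, Suc p) \<and> snd (word i) \<le> stamp (k, Suc p) + 1)))"

fun good_frm :: "nat \<Rightarrow> real \<Rightarrow> bform \<Rightarrow> bool" where
  "good_frm K v BTrue = True"
| "good_frm K v (BAtom q f) = good_conf (Suc K) q (if f = Reset then 0 else v)"
| "good_frm K v (BAnd \<phi> \<psi>) = (good_frm K v \<phi> \<and> good_frm K v \<psi>)"
| "good_frm K v _ = False"

fun good :: "pos \<Rightarrow> bool" where
  "good (Conf K q v) = good_conf K q v"
| "good (Frm K v \<phi>) = good_frm K v \<phi>"
| "good WinSink = True"
| "good LoseSink = False"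

lemma good_conf_wait: "good_conf (Suc i) wait v"
  by (simp add: good_conf_def)

lemma trans_main:
  assumes "l < L" "f < 2" "b < 2"
  shows "a < 2 * T \<Longrightarrow> a mod 2 = b \<Longrightarrow> \<not> forb l (a div 2) \<Longrightarrow> trans (main l f b) a False =
       BAnd (BAtom (main l (if sel l (a div 2) then 1 else f) (1 - b)) Nop)
         (BAtom (2 * img l f (a div 2) + par l b) Reset)"
    and "\<not> a < 2 * T \<Longrightarrow> f = 1 \<Longrightarrow> nxt l (a - 2 * T) \<Longrightarrow> trans (main l f b) a True =
       BAnd (BAtom (main (a - 2 * T) 0 0) Reset) (BAtom wait Nop)"
  using main_decode[OF assms] by (simp_all add: trans_def)

lemma good_main:
  assumes pl: "place i = (k, p)"
  defines "v' \<equiv> stamp (place (Suc i)) - stamp (k, 0)"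
  shows "good (Frm (Suc i) v' (trans (main (ctl k) (flag (ctl k) (take p (u k))) (p mod 2)) (fst (word (Suc i))) (v' > 1)))"
proof (cases "p < n k")
  case True
  then have pl': "place (Suc i) = (k, Suc p)" by (simp add: place_Suc pl succ_place_def)
  have late: "\<not> v' > 1"
    using offset_bounds[of k "Suc p"] stamp_offset[of k "Suc p"] by (simp add: v'_def pl')
  let ?a = "fst (word (Suc i))" and ?f = "flag (ctl k) (take p (u k))"
  have a: "?a = 2 * (u k ! p) + p mod 2" by (simp add: word_def pl' symbol_def)
  have ut: "u k ! p < T" using u_less True by (meson lessThan_iff nth_mem subsetD)
  have a': "?a div 2 = u k ! p" "?a mod 2 = p mod 2" "?a < 2 * T" using ut unfolding a by presburger+
  have nf: "\<not> forb (ctl k) (?a div 2)" using u_forb True a' by simp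
  have "1 - p mod 2 = Suc p mod 2" by presburger
  then have "trans (main (ctl k) ?f (p mod 2)) ?a (v' > 1) =
    BAnd (BAtom (main (ctl k) (flag (ctl k) (take (Suc p) (u k))) (Suc p mod 2)) Nop)
      (BAtom (2 * imgs (ctl k) (u k) ! p + par (ctl k) (p mod 2)) Reset)"
    using trans_main(1)[OF ctl_less flag_less _ a'(3,2) nf] late True a'
    by (simp add: flag_Suc imgs_def)
  moreover have "good_conf (Suc (Suc i)) (main (ctl k) (flag (ctl k) (take (Suc p) (u k))) (Suc p mod 2)) v'"
    unfolding good_conf_def v'_def pl' by (intro disjI2 exI[of _ "Suc i"] conjI disjI1 exI[of _ k] exI[of _ "Suc p"]) (auto simp: pl')
  moreover have "good_conf (Suc (Suc i)) (2 * imgs (ctl k) (u k) ! p + par (ctl k) (p mod 2)) 0"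
    unfolding good_conf_def by (intro disjI2 exI[of _ "Suc i"] conjI exI[of _ k] exI[of _ p]) (auto simp: word_def pl' True)
  ultimately show ?thesis by simp
next
  case False
  with place_valid[OF pl] have pn: "p = n k" by simp
  then have pl': "place (Suc i) = (Suc k, 0)" by (simp add: place_Suc pl succ_place_def)
  have late: "v' > 1" using stamp_Suc_0[of k] drift_pos[of k] by (simp add: v'_def pl')
  let ?a = "fst (word (Suc i))"
  have a: "?a = 2 * T + ctl (Suc k)" by (simp add: word_def pl' symbol_def)
  have f1: "flag (ctl k) (take p (u k)) = 1" using u_sel[of k] by (simp add: pn flag_def)
  have "trans (main (ctl k) (flag (ctl k) (take p (u k))) (p mod 2)) ?a (v' > 1) =
    BAnd (BAtom (main (ctl (Suc k)) 0 0) Reset) (BAtom wait Nop)"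
    using trans_main(2)[OF ctl_less[of k] flag_less[of "ctl k" "take p (u k)"], of "p mod 2" ?a] late f1
      ctl_nxt[of k] a by simp
  moreover have "good_conf (Suc (Suc i)) (main (ctl (Suc k)) 0 0) 0"
    unfolding good_conf_def
    by (intro disjI2 exI[of _ "Suc i"] conjI disjI1 exI[of _ "Suc k"] exI[of _ 0]) (auto simp: pl' flag_def)
  ultimately show ?thesis by (simp add: good_conf_wait)
qed

lemma good_Conf_trans:
  assumes g: "good (Conf K q v)"
  defines "v' \<equiv> v + tstamp word (Suc K) - tstamp word K"
  shows "good (Frm K v' (trans q (fst (word K)) (v' > 1)))"
proof -
  from g have "good_conf K q v" by simp
  then consider
      (start) "K = 0" "q = start" "v = 0"
    | (wait) i where "K = Suc i" "q = wait"
    | (main) i k p where "K = Suc i" "place i = (k, p)" "q = main (ctl k) (flag (ctl k) (take p (u k))) (p mod 2)"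
        "v = stamp (k, p) - stamp (k, 0)"
    | (copy) i k p where "K = Suc i" "p < n k" "q = 2 * imgs (ctl k) (u k) ! p + par (ctl k) (p mod 2)"
        "v = snd (word i) - stamp (k, Suc p)" "snd (word i) \<le> stamp (k, Suc p) + 1"
    unfolding good_conf_def by blast
  then show ?thesis
  proof cases
    case start
    have "fst (word 0) = 2 * T" by (simp add: word_def place_def symbol_def ctl_0)
    then have "trans q (fst (word K)) (v' > 1) = BAnd (BAtom (main 0 0 0) Reset) (BAtom wait Nop)"
      using start by (simp add: trans_def start_def wait_def)
    moreover have "good_conf (Suc 0) (main 0 0 0) 0"
      unfolding good_conf_def
      by (intro disjI2 exI[of _ 0] conjI disjI1 exI[of _ 0]) (auto simp: place_def flag_def ctl_0)
    ultimately show ?thesis using start by (simp add: good_conf_wait)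
  next
    case wait
    moreover have "\<not> wait < 2 * T" by (simp add: wait_def)
    ultimately show ?thesis by (simp add: trans_def good_conf_wait)
  next
    case (main i k p)
    have "v' = stamp (place (Suc i)) - stamp (k, 0)"
      using main by (simp add: v'_def tstamp_def word_def)
    with good_main[OF main(2)] main show ?thesis by simp
  next
    case (copy i k p)
    have v': "v' = snd (word (Suc i)) - stamp (k, Suc p)" using copy by (simp add: v'_def tstamp_def)
    have q: "q < 2 * T"
    proof -
      have "imgs (ctl k) (u k) ! p < T" using copy(2) u_less[of k] res_less dft_less
        by (auto simp: imgs_def img_def subset_iff)
      moreover have "par (ctl k) (p mod 2) < 2" by (auto simp: par_def)
      ultimately show ?thesis using copy(3) by linarith
    qed
    show ?thesis
    proof (cases "v' > 1")
      case True
      then have "fst (word (Suc i)) = q" using image_event[OF copy(2) copy(5)] v' copy(3) by simp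
      with True q copy(1) show ?thesis by (simp add: trans_def)
    next
      case False
      have "good_conf (Suc (Suc i)) q v'"
        unfolding good_conf_def using copy(2,3) v' False
        by (intro disjI2 exI[of _ "Suc i"] conjI exI[of _ k] exI[of _ p]) auto
      with False q copy(1) show ?thesis by (simp add: trans_def)
    qed
  qed
qed

lemma good_edge:
  assumes "edge aut word x y" "good x" "legal_pos aut x"
  shows "good y"
proof (cases x)
  case (Conf K q v)
  then have "y = Frm K (v + tstamp word (Suc K) - tstamp word K)
     (trans q (fst (word K)) (v + tstamp word (Suc K) - tstamp word K > 1))"
    using assms edge_Conf[of q word K, OF _ word_letter] by simp
  with good_Conf_trans assms(2) Conf show ?thesis by metis
next
  case (Frm K v \<phi>)
  with assms(1,2) show ?thesis by (cases) auto
qed (use assms(1,2) in \<open>auto elim: edge.cases\<close>)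

lemma reach_good: "reach aut word x \<Longrightarrow> good x"
proof -
  assume "reach aut word x"
  then have "(edge aut word)\<^sup>*\<^sup>* (Conf 0 (init aut) 0) x" by (simp add: reach_def)
  then show ?thesis
  proof (induction rule: rtranclp_induct)
    case (step y z)
    then have "legal_pos aut y" using reach_legal_pos[OF _ aut_class(1,2)] by (simp add: reach_def)
    with step show ?case by (metis good_edge)
  qed (simp add: good_conf_def)
qed

lemma wait_wins:
  assumes p: "path aut word p" and c: "p m = Conf K wait v"
  shows "\<exists>m. p m = WinSink"
proof (rule ccontr)
  assume nw: "\<nexists>m. p m = WinSink"
  have ws: "wait < nst" by (simp add: wait_def nst_def)
  have step: "fst (word (K + j)) \<noteq> 2 * T \<and> (\<exists>v. p (m + 2 * Suc j) = Conf (K + Suc j) wait v)"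
    if "p (m + 2 * j) = Conf (K + j) wait v" for j v
  proof -
    have "edge aut word (Conf (K + j) wait v) (p (Suc (m + 2 * j)))"
      using p that unfolding path_def by metis
    then obtain v' where 1: "p (Suc (m + 2 * j)) = Frm (K + j) v' (if fst (word (K + j)) = 2 * T then BTrue else BAtom wait Nop)"
      unfolding edge_Conf[of wait word "K + j", OF ws word_letter] by (auto simp: trans_def wait_def)
    have "edge aut word (p (Suc (m + 2 * j))) (p (Suc (Suc (m + 2 * j))))" using p unfolding path_def by metis
    then have "if fst (word (K + j)) = 2 * T then p (Suc (Suc (m + 2 * j))) = WinSink
       else p (Suc (Suc (m + 2 * j))) = Conf (Suc (K + j)) wait v'"
      unfolding 1 by cases (auto split: if_splits)
    with nw show ?thesis by (auto split: if_splits)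
  qed
  have all: "\<exists>v. p (m + 2 * j) = Conf (K + j) wait v" for j
    by (induction j) (use c step in auto)
  \<comment> \<open>By \<open>place_le\<close> the control letter of block \<open>k\<close> is event
    \<open>k\<close> or a later one, so the copy has not read it yet.\<close>
  obtain k where k: "k > K" "ctl k = 0" using ctl_inf by blast
  obtain i where i: "place i = (k, 0)" using place_onto[of 0 k] by auto
  have "K \<le> i" using place_le[of i] i k by simp
  moreover have "fst (word i) = 2 * T" by (simp add: word_def i symbol_def k)
  ultimately show False using step[of "i - K"] all[of "i - K"] by auto
qed

lemma word_accepted: "accepts aut word"
proof (rule accepts_intro[OF aut_class])
  show "\<not> reach aut word LoseSink" using reach_good by force
next
  fix p m K q v
  assume h: "p 0 = Conf 0 (init aut) 0" "path aut word p" "p m = Conf K q v" "rank aut q = 1"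
  have q: "q < nst" using reach_legal_pos[OF path_reach[OF h(2,1)] aut_class(1,2), of m] h(3) by simp
  have "q = wait"
  proof (rule ccontr)
    assume "q \<noteq> wait"
    with rank_aut[OF q] h(4) show False by simp
  qed
  with wait_wins[OF h(2)] h(3) show "\<exists>n. p n = WinSink" by blast
qed

end

section \<open>Simulation of counter programs\<close>

abbreviation opc :: "instr \<Rightarrow> nat" where "opc c \<equiv> fst c"
abbreviation reg :: "instr \<Rightarrow> nat" where "reg c \<equiv> fst (snd c)"
abbreviation jmp :: "instr \<Rightarrow> nat" where "jmp c \<equiv> fst (snd (snd c))"
abbreviation jmp0 :: "instr \<Rightarrow> nat" where "jmp0 c \<equiv> snd (snd (snd c))"

text \<open>Item types: 0 is the pool, 1 a dead item, 2 a spent item, and \<open>3 + r\<close> a unit of register \<open>r\<close>.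
  Control letters: 0 ends an epoch, 1 ends a phase, \<open>2 + 2 * p\<close> executes the instruction at \<open>p\<close>
  (nonzero branch of a test), and \<open>3 + 2 * p\<close> takes the zero branch.\<close>

definition csel :: "(nat \<Rightarrow> instr) \<Rightarrow> nat \<Rightarrow> nat \<Rightarrow> bool" where
  "csel P l t = (if l = 0 then t = 1 else if l = 1 then t \<noteq> 1
     else if opc (P ((l - 2) div 2)) = 0 then False
     else if opc (P ((l - 2) div 2)) = 1 then t = 0
     else if l mod 2 = 0 then t = 3 + reg (P ((l - 2) div 2)) else t = 0)"

text \<open>Bans are the only way to force absence. They are robust: inserted items can violate a
  ban but never lift one.\<close>

definition cforb :: "(nat \<Rightarrow> instr) \<Rightarrow> nat \<Rightarrow> nat \<Rightarrow> bool" where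
  "cforb P l t = (if l = 0 then t \<noteq> 1 else if l = 1 then t = 0
     else 1 < opc (P ((l - 2) div 2)) \<and> l mod 2 = 1 \<and> t = 3 + reg (P ((l - 2) div 2)))"

text \<open>A zero branch, too, turns a pool item into a spent one; otherwise a loop of zero
  branches could keep a phase from ever ending.\<close>

definition cres :: "(nat \<Rightarrow> instr) \<Rightarrow> nat \<Rightarrow> nat" where
  "cres P l = (if l = 0 then 0 else if l = 1 then 1
     else if opc (P ((l - 2) div 2)) = 1 then 3 + reg (P ((l - 2) div 2)) else 2)"

definition cdft :: "nat \<Rightarrow> nat \<Rightarrow> nat" where
  "cdft l t = (if l = 0 then 0 else if l = 1 then (if t = 1 then 1 else 0) else t)"

definition ctgt :: "(nat \<Rightarrow> instr) \<Rightarrow> nat \<Rightarrow> nat" where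
  "ctgt P l = (if l < 2 then 0
     else if opc (P ((l - 2) div 2)) = 1 \<or> l mod 2 = 0 then jmp (P ((l - 2) div 2))
     else jmp0 (P ((l - 2) div 2)))"

text \<open>Letters 0 and 1 may always follow. That a phase or epoch does not end early, and that a
  test takes the right branch, is left to \<open>csel\<close> and \<open>cforb\<close>.\<close>

definition cnxt :: "(nat \<Rightarrow> instr) \<Rightarrow> nat \<Rightarrow> nat \<Rightarrow> bool" where
  "cnxt P l l' \<longleftrightarrow> l' < 2 \<or> (l' - 2) div 2 = ctgt P l"

locale machine =
  fixes P :: "nat \<Rightarrow> instr" and m N :: nat
  assumes reg_less: "reg (P p) < m" and pc_less: "opc (P p) \<noteq> 0 \<Longrightarrow> p < N"
begin

sublocale block_ata "m + 3" "Suc (Suc (2 * N))" "csel P" "cforb P" "cres P" cdft "cnxt P"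
  by unfold_locales (use reg_less in \<open>auto simp: cres_def cdft_def\<close>)

definition conf :: "nat \<Rightarrow> nat \<times> (nat \<Rightarrow> nat)" where
  "conf i = (cstep P ^^ i) (0, \<lambda>_. 0)"

definition halts :: bool where
  "halts \<longleftrightarrow> (\<exists>i. opc (P (fst (conf i))) = 0)"

lemma conf_Suc: "conf (Suc i) = cstep P (conf i)"
  by (simp add: conf_def)

definition alive :: "nat list \<Rightarrow> nat multiset" where
  "alive u = filter_mset (\<lambda>t. t \<noteq> 1) (mset u)"

lemma obtain_selected:
  assumes "\<exists>t\<in>set u. csel P l t"
  obtains v x z where "u = v @ x # z" "csel P l x" "\<forall>t\<in>set v. \<not> csel P l t"
    "imgs l u = map (cdft l) v @ cres P l # map (cdft l) z"
  using split_list_first_prop[OF assms] imgs_split by metis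

text \<open>All items before the first selected one are dead, so exactly one live item dies and the
  others return to the pool.\<close>

lemma alive_imgs_phase_end:
  assumes "\<exists>t\<in>set u. csel P 1 t"
  shows "replicate_mset (size (alive u) - 1) 0 = alive (imgs 1 u)" "0 < size (alive u)"
proof -
  from obtain_selected[OF assms] obtain v x z where s: "u = v @ x # z" "csel P 1 x" "\<forall>t\<in>set v. \<not> csel P 1 t"
    "imgs 1 u = map (cdft 1) v @ cres P 1 # map (cdft 1) z" .
  have "cdft 1 t = 1" if "t \<in> set v" for t using s(3) that by (simp add: csel_def cdft_def)
  then have v: "alive (map (cdft 1) v) = {#}" "alive v = {#}"
    using s(3) by (auto simp: alive_def csel_def)
  have z: "alive (map (cdft 1) z) = replicate_mset (size (alive z)) 0"
    by (induction z) (auto simp: alive_def cdft_def)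
  have x: "x \<noteq> 1" using s(2) by (simp add: csel_def)
  have "alive (imgs 1 u) = replicate_mset (size (alive z)) 0"
    using v z unfolding s(4) by (simp add: alive_def cres_def)
  moreover have "size (alive u) = Suc (size (alive z))"
    using v x unfolding s(1) by (simp add: alive_def)
  ultimately show "replicate_mset (size (alive u) - 1) 0 = alive (imgs 1 u)" "0 < size (alive u)" by simp_all
qed

lemma alive_imgs_instr:
  assumes "\<exists>t\<in>set u. csel P l t" "2 \<le> l"
  obtains x where "csel P l x" "x \<in># alive u" "alive (imgs l u) = add_mset (cres P l) (alive u - {#x#})"
proof -
  from obtain_selected[OF assms(1)] obtain v x z where s: "u = v @ x # z" "csel P l x" "\<forall>t\<in>set v. \<not> csel P l t"
    "imgs l u = map (cdft l) v @ cres P l # map (cdft l) z" .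
  have d: "map (cdft l) v = v" "map (cdft l) z = z" using assms(2) by (auto simp: cdft_def map_idI)
  have "x \<noteq> 1" "cres P l \<noteq> 1" using s(2) assms(2) by (auto simp: csel_def cres_def split: if_splits)
  with d s have "x \<in># alive u" "alive (imgs l u) = add_mset (cres P l) (alive u - {#x#})"
    by (auto simp: alive_def)
  with s(2) that show thesis by blast
qed

lemma alive_imgs_epoch_end:
  assumes "\<forall>t\<in>set u. \<not> cforb P 0 t"
  shows "alive u = {#}" "alive (imgs 0 u) = replicate_mset (length u) 0"
proof -
  show "alive u = {#}" using assms by (auto simp: alive_def cforb_def)
  have "x = 0" if "x \<in> set (imgs 0 u)" for x
    using that by (auto simp: imgs_def img_def cres_def cdft_def)
  then have "imgs 0 u = replicate (length u) 0" by (intro replicate_eqI) auto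
  moreover have "alive (replicate j 0) = replicate_mset j 0" for j
    by (induction j) (auto simp: alive_def)
  ultimately show "alive (imgs 0 u) = replicate_mset (length u) 0" by metis
qed

text \<open>As long as there are exactly \<open>K\<close> live items, no live item has been inserted
  and the phase is a faithful simulation. It is stuck: its pool is nonempty until the halting
  instruction, which selects nothing. So a phase ends only with more than \<open>K\<close> live
  items, and its death leaves at least \<open>K\<close>; the epoch end, which requires none, is
  never reached.\<close>

lemma faulty_run_not_halts:
  assumes "faulty_run ctl u"
  shows "\<not> halts"
proof
  assume halts
  then obtain H where H: "opc (P (fst (conf H))) = 0" by (auto simp: halts_def)
  define K where "K = Suc H"
  let ?A = "\<lambda>k. alive (u k)"
  from assms have ctl: "\<And>k. \<exists>j>k. ctl j = 0" "\<And>k. cnxt P (ctl k) (ctl (Suc k))"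
    and sel: "\<And>k. \<exists>t\<in>set (u k). csel P (ctl k) t" and forb: "\<And>k. \<forall>t\<in>set (u k). \<not> cforb P (ctl k) t"
    and emb: "\<And>k y. count_list (imgs (ctl k) (u k)) y \<le> count_list (u (Suc k)) y"
    and grow: "\<And>k. ctl k = 0 \<Longrightarrow> length (u k) < length (u (Suc k))"
    unfolding faulty_run_def by auto
  have sub: "mset (imgs (ctl k) (u k)) \<subseteq># mset (u (Suc k))" for k
    using emb by (simp add: subseteq_mset_def count_mset)
  have asub: "alive (imgs (ctl k) (u k)) \<subseteq># ?A (Suc k)" for k
    unfolding alive_def by (rule multiset_filter_mono[OF sub])
  have len: "length (u k) \<le> length (u (Suc k))" for k
    using size_mset_mono[OF sub[of k]] by simp
  have len_mono: "i \<le> j \<Longrightarrow> length (u i) \<le> length (u j)" for i j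
    using len by (rule lift_Suc_mono_le)
  \<comment> \<open>Blocks never shrink and every epoch end enlarges them, so some epoch starts with
    more than \<open>K\<close> items.\<close>
  have large: "\<exists>k. ctl k = 0 \<and> M \<le> length (u k)" for M
  proof (induction M)
    case 0
    then show ?case using ctl(1) by blast
  next
    case (Suc M)
    then obtain k where k: "ctl k = 0" "M \<le> length (u k)" by blast
    obtain j where "j > k" "ctl j = 0" using ctl(1) by blast
    with grow[OF k(1)] len_mono[of "Suc k" j] k show ?case by (intro exI[of _ j]) auto
  qed
  \<comment> \<open>The last conjunct says that \<open>i\<close> steps took at most \<open>i\<close>
    items from the pool; together with \<open>i \<le> H < K\<close> the pool is nonempty.\<close>
  define exact where "exact k i \<longleftrightarrow> i \<le> H \<and> size (?A k) = K \<and>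
    (2 \<le> ctl k \<longrightarrow> (ctl k - 2) div 2 = fst (conf i)) \<and>
    (\<forall>r. count (?A k) (3 + r) = snd (conf i) r) \<and> K \<le> count (?A k) 0 + i" for k i
  define inv where "inv k \<longleftrightarrow> K < size (?A k) \<or> (\<exists>i. exact k i)" for k
  have inv_E: "ctl k \<noteq> 0" if "inv k" for k
  proof
    assume "ctl k = 0"
    then have "?A k = {#}" using alive_imgs_epoch_end(1) forb[of k] by metis
    with that show False by (auto simp: inv_def exact_def K_def)
  qed
  have step: "inv (Suc k)" if inv: "inv k" for k
  proof -
    note E = inv_E[OF inv]
    show ?thesis
    proof (cases "ctl k = 1")
      case True
      have c0: "count (?A k) 0 = 0"
        using forb[of k] True by (auto simp: cforb_def alive_def count_eq_zero_iff)
      have big: "K < size (?A k)" using inv c0 by (auto simp: inv_def exact_def K_def)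
      have rep: "replicate_mset (size (?A k) - 1) 0 \<subseteq># ?A (Suc k)"
        using asub[of k] alive_imgs_phase_end(1)[of "u k"] sel[of k] True by simp
      from size_mset_mono[OF this] big have ge: "K \<le> size (?A (Suc k))" by simp
      show ?thesis
      proof (cases "K < size (?A (Suc k))")
        case False
        with ge size_mset_mono[OF rep] big have sz: "size (?A (Suc k)) = K" "size (?A k) - 1 = K" by auto
        \<comment> \<open>A sub-multiset of full size is everything: nothing live was inserted, and
          the new phase starts with \<open>K\<close> pool items.\<close>
        have "?A (Suc k) = replicate_mset K 0"
          using rep sz by (metis mset_subset_size nat_neq_iff size_replicate_mset subset_mset.less_le)
        moreover have "2 \<le> ctl (Suc k) \<longrightarrow> (ctl (Suc k) - 2) div 2 = 0"
          using ctl(2)[of k] True by (auto simp: cnxt_def ctgt_def)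
        ultimately have "exact (Suc k) 0" using sz by (simp add: exact_def conf_def)
        then show ?thesis by (auto simp: inv_def)
      qed (simp add: inv_def)
    next
      case False
      with E have l2: "2 \<le> ctl k" by simp
      from alive_imgs_instr[OF sel l2] obtain x where x: "csel P (ctl k) x" "x \<in># ?A k"
        "alive (imgs (ctl k) (u k)) = add_mset (cres P (ctl k)) (?A k - {#x#})" .
      have rep: "add_mset (cres P (ctl k)) (?A k - {#x#}) \<subseteq># ?A (Suc k)" using asub[of k] x by simp
      have sz: "size (add_mset (cres P (ctl k)) (?A k - {#x#})) = size (?A k)"
        using multi_member_split[OF x(2)] by auto
      have ge: "size (?A k) \<le> size (?A (Suc k))" using size_mset_mono[OF rep] sz by simp
      show ?thesis
      proof (cases "K < size (?A (Suc k))")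
        case le: False
        with ge inv obtain i where i: "exact k i" by (auto simp: inv_def)
        with le ge have eqs: "size (?A (Suc k)) = K" "size (?A k) = K" by (auto simp: exact_def)
        have A: "?A (Suc k) = add_mset (cres P (ctl k)) (?A k - {#x#})"
          using rep sz eqs by (metis mset_subset_size nat_neq_iff subset_mset.less_le)
        define p where "p = fst (conf i)"
        define R where "R = snd (conf i)"
        have p: "(ctl k - 2) div 2 = p" using i l2 by (simp add: exact_def p_def)
        have R: "count (?A k) (3 + r) = R r" for r using i by (simp add: exact_def R_def)
        have op: "opc (P p) \<noteq> 0" using x(1) l2 p by (auto simp: csel_def split: if_splits)
        have "i \<noteq> H" using op H by (auto simp: p_def)
        then have iH: "Suc i \<le> H" using i by (simp add: exact_def)
        have conf: "conf (Suc i) = cstep P (p, R)" by (simp add: conf_Suc p_def R_def)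
        have tgt: "2 \<le> ctl (Suc k) \<longrightarrow> (ctl (Suc k) - 2) div 2 = ctgt P (ctl k)"
          using ctl(2)[of k] by (auto simp: cnxt_def)
        obtain o' r j j0 where ins: "P p = (o', r, j, j0)" by (cases "P p") auto
        have xc: "0 < count (?A k) x" using x(2) by simp
        have Ki: "K \<le> count (?A k) 0 + i" using i by (simp add: exact_def)
        have "exact (Suc k) (Suc i)"
        proof (cases "o' = 1")
          case True
          then have "x = 0" "cres P (ctl k) = 3 + r" "ctgt P (ctl k) = j"
            using x(1) l2 p ins by (auto simp: csel_def cres_def ctgt_def)
          moreover have "conf (Suc i) = (j, R(r := Suc (R r)))" using True ins by (simp add: conf cstep_def)
          ultimately show ?thesis using A iH eqs tgt R Ki xc by (auto simp: exact_def)
        next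
          case dec: False
          then have o2: "o' \<noteq> 0" using op ins by simp
          show ?thesis
          proof (cases "ctl k mod 2 = 0")
            case True
            then have xx: "x = 3 + r" "cres P (ctl k) = 2" "ctgt P (ctl k) = j"
              using x(1) l2 p ins dec o2 by (auto simp: csel_def cres_def ctgt_def)
            then have "R r > 0" using xc R[of r] by simp
            then have "conf (Suc i) = (j, R(r := R r - 1))" using dec o2 ins by (simp add: conf cstep_def)
            with xx show ?thesis using A iH eqs tgt R Ki by (auto simp: exact_def)
          next
            case False
            then have xx: "x = 0" "cres P (ctl k) = 2" "ctgt P (ctl k) = j0"
              using x(1) l2 p ins dec o2 by (auto simp: csel_def cres_def ctgt_def)
            have "\<forall>t\<in>set (u k). t \<noteq> 3 + r"
              using forb[of k] False l2 p ins dec o2 by (auto simp: cforb_def)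
            then have "count (?A k) (3 + r) = 0" by (auto simp: alive_def count_eq_zero_iff)
            then have "R r = 0" using R[of r] by simp
            then have "conf (Suc i) = (j0, R)" using dec o2 ins by (simp add: conf cstep_def)
            with xx show ?thesis using A iH eqs tgt R Ki xc by (auto simp: exact_def)
          qed
        qed
        then show ?thesis by (auto simp: inv_def)
      qed (simp add: inv_def)
    qed
  qed
  obtain k where k: "ctl k = 0" "Suc K \<le> length (u k)" using large by blast
  have "inv (Suc k)"
  proof -
    have "replicate_mset (length (u k)) 0 \<subseteq># ?A (Suc k)"
      using asub[of k] alive_imgs_epoch_end(2)[of "u k"] forb[of k] k by simp
    from size_mset_mono[OF this] k show ?thesis by (simp add: inv_def)
  qed
  then have all: "inv (Suc k + j)" for j by (induction j) (use step in auto)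
  obtain j where j: "j > Suc k" "ctl j = 0" using ctl(1) by blast
  with all[of "j - Suc k"] inv_E[of j] show False by simp
qed

section \<open>The error-free run of a machine that does not halt\<close>

definition pick :: "nat \<times> nat list \<Rightarrow> nat" where
  "pick = (\<lambda>(p, u). if set u \<subseteq> {1} then 0 else if 0 \<notin> set u then 1
     else if opc (P p) = 1 \<or> 3 + reg (P p) \<in> set u then 2 + 2 * p else 3 + 2 * p)"

definition advance :: "nat \<times> nat list \<Rightarrow> nat \<times> nat list" where
  "advance s = (ctgt P (pick s), (if pick s = 0 then [0] else []) @ imgs (pick s) (snd s))"

definition simulates :: "nat \<times> nat list \<Rightarrow> bool" where
  "simulates s \<longleftrightarrow> snd s \<noteq> [] \<and> set (snd s) \<subseteq> {..<m + 3} \<and>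
     (\<exists>i. fst (conf i) = fst s \<and> (\<forall>r. count_list (snd s) (3 + r) = snd (conf i) r))"

lemma pick_instr:
  assumes "2 \<le> pick (p, u)" "opc (P p) \<noteq> 0"
  shows "(pick (p, u) - 2) div 2 = p" "0 \<in> set u" "\<not> set u \<subseteq> {1}"
    "pick (p, u) mod 2 = (if opc (P p) = 1 \<or> 3 + reg (P p) \<in> set u then 0 else 1)"
  using assms by (auto simp: pick_def split: if_splits)

text \<open>The cases of \<open>pick\<close> are ordered for this: once the ends of epoch and phase
  are ruled out, a pool item is available to pay for an increment or a zero branch.\<close>

lemma pick_ok:
  assumes "u \<noteq> []" "opc (P p) \<noteq> 0"
  shows "pick (p, u) < Suc (Suc (2 * N))" "\<exists>t\<in>set u. csel P (pick (p, u)) t" "\<forall>t\<in>set u. \<not> cforb P (pick (p, u)) t"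
proof -
  have p: "p < N" using pc_less assms by blast
  then show "pick (p, u) < Suc (Suc (2 * N))" by (simp add: pick_def)
  show "\<exists>t\<in>set u. csel P (pick (p, u)) t"
  proof (cases "pick (p, u) < 2")
    case True
    then show ?thesis using assms(1) by (cases u) (auto simp: pick_def csel_def split: if_splits)
  next
    case False
    then have "2 \<le> pick (p, u)" by simp
    note i = pick_instr[OF this assms(2)]
    show ?thesis using False i assms(2) unfolding csel_def by (auto split: if_splits)
  qed
  show "\<forall>t\<in>set u. \<not> cforb P (pick (p, u)) t"
  proof (cases "pick (p, u) < 2")
    case True
    then show ?thesis by (auto simp: pick_def cforb_def split: if_splits) (metis gr_zeroI)+
  next
    case False
    then have "2 \<le> pick (p, u)" by simp
    note i = pick_instr[OF this assms(2)]
    show ?thesis using False i assms(2) unfolding cforb_def by (auto split: if_splits)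
  qed
qed

lemma imgs_instr:
  assumes "\<exists>t\<in>set u. csel P l t" "2 \<le> l"
  obtains v x z where "u = v @ x # z" "csel P l x" "imgs l u = v @ cres P l # z"
proof -
  from obtain_selected[OF assms(1)] obtain v x z where s: "u = v @ x # z" "csel P l x" "\<forall>t\<in>set v. \<not> csel P l t"
    "imgs l u = map (cdft l) v @ cres P l # map (cdft l) z" .
  have d: "map (cdft l) v = v" "map (cdft l) z = z" using assms(2) by (auto simp: cdft_def map_idI)
  from s(4) have "imgs l u = v @ cres P l # z" unfolding d .
  with s(1,2) that show thesis by blast
qed

lemma instr_effect:
  assumes u: "u \<noteq> []" and op: "opc (P p) \<noteq> 0" and pk: "2 \<le> pick (p, u)"
  obtains v x z where "u = v @ x # z" "imgs (pick (p, u)) u = v @ cres P (pick (p, u)) # z"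
    "opc (P p) = 1 \<and> x = 0 \<and> cres P (pick (p, u)) = 3 + reg (P p) \<and> ctgt P (pick (p, u)) = jmp (P p) \<or>
     1 < opc (P p) \<and> x = 3 + reg (P p) \<and> cres P (pick (p, u)) = 2 \<and> ctgt P (pick (p, u)) = jmp (P p) \<or>
     1 < opc (P p) \<and> x = 0 \<and> 3 + reg (P p) \<notin> set u \<and> cres P (pick (p, u)) = 2 \<and> ctgt P (pick (p, u)) = jmp0 (P p)"
proof -
  note i = pick_instr[OF pk op]
  from imgs_instr[OF pick_ok(2)[OF u op] pk] obtain v x z where
    s: "u = v @ x # z" "csel P (pick (p, u)) x" "imgs (pick (p, u)) u = v @ cres P (pick (p, u)) # z" .
  have "opc (P p) = 1 \<and> x = 0 \<and> cres P (pick (p, u)) = 3 + reg (P p) \<and> ctgt P (pick (p, u)) = jmp (P p) \<or>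
     1 < opc (P p) \<and> x = 3 + reg (P p) \<and> cres P (pick (p, u)) = 2 \<and> ctgt P (pick (p, u)) = jmp (P p) \<or>
     1 < opc (P p) \<and> x = 0 \<and> 3 + reg (P p) \<notin> set u \<and> cres P (pick (p, u)) = 2 \<and> ctgt P (pick (p, u)) = jmp0 (P p)"
    using s(2) i(1,4) op pk unfolding csel_def cres_def ctgt_def by (auto split: if_splits)
  with s that show thesis by blast
qed

lemma imgs_set_less: "set u \<subseteq> {..<m + 3} \<Longrightarrow> set (imgs l u) \<subseteq> {..<m + 3}"
  using res_less dft_less by (auto simp: imgs_def img_def subset_iff)

text \<open>The end of a phase or epoch leaves no register items, which matches
  \<open>conf 0\<close>; any other control letter performs one machine step.\<close>

lemma simulates_advance:
  assumes sim: "simulates s" and run: "\<not> halts"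
  shows "simulates (advance s)"
proof -
  obtain p u where s: "s = (p, u)" by force
  from sim obtain i where i: "fst (conf i) = p" "\<And>r. count_list u (3 + r) = snd (conf i) r"
    and u: "u \<noteq> []" "set u \<subseteq> {..<m + 3}" by (auto simp: simulates_def s)
  have op: "opc (P p) \<noteq> 0" using run i(1) by (auto simp: halts_def)
  have "length (snd (advance s)) \<noteq> 0" using u(1) by (simp add: advance_def s)
  then have 1: "snd (advance s) \<noteq> []" by auto
  have 2: "set (snd (advance s)) \<subseteq> {..<m + 3}"
    using imgs_set_less[OF u(2), of "pick s"] by (auto simp: advance_def s)
  have "\<exists>j. fst (conf j) = fst (advance s) \<and> (\<forall>r. count_list (snd (advance s)) (3 + r) = snd (conf j) r)"
  proof (cases "2 \<le> pick s")
    case False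
    have "count_list (imgs (pick s) u) (3 + r) = 0" for r
    proof -
      have "3 + r \<notin> set (imgs (pick s) u)"
        using False by (auto simp: imgs_def img_def cres_def cdft_def split: if_splits)
      then show ?thesis by (simp add: count_list_0_iff)
    qed
    then have "fst (conf 0) = fst (advance s) \<and> (\<forall>r. count_list (snd (advance s)) (3 + r) = snd (conf 0) r)"
      using False by (auto simp: advance_def conf_def ctgt_def s)
    then show ?thesis by blast
  next
    case True
    from instr_effect[OF u(1) op True[unfolded s]] obtain v x z where
      e: "u = v @ x # z" "imgs (pick (p, u)) u = v @ cres P (pick (p, u)) # z"
      "opc (P p) = 1 \<and> x = 0 \<and> cres P (pick (p, u)) = 3 + reg (P p) \<and> ctgt P (pick (p, u)) = jmp (P p) \<or>
       1 < opc (P p) \<and> x = 3 + reg (P p) \<and> cres P (pick (p, u)) = 2 \<and> ctgt P (pick (p, u)) = jmp (P p) \<or>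
       1 < opc (P p) \<and> x = 0 \<and> 3 + reg (P p) \<notin> set u \<and> cres P (pick (p, u)) = 2 \<and> ctgt P (pick (p, u)) = jmp0 (P p)"
      by blast
    have adv: "advance s = (ctgt P (pick (p, u)), v @ cres P (pick (p, u)) # z)"
      using True e(2) by (simp add: advance_def s)
    obtain o' r j j0 where ins: "P p = (o', r, j, j0)" by (cases "P p") auto
    define R where "R = snd (conf i)"
    have cs: "conf (Suc i) = cstep P (p, R)" unfolding conf_Suc R_def i(1)[symmetric] by simp
    have R: "R q = count_list v (3 + q) + (if x = 3 + q then 1 else 0) + count_list z (3 + q)" for q
      unfolding R_def i(2)[of q, symmetric] e(1) by simp
    have "fst (conf (Suc i)) = fst (advance s) \<and> (\<forall>r. count_list (snd (advance s)) (3 + r) = snd (conf (Suc i)) r)"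
      using e(3)
    proof (elim disjE)
      assume h: "opc (P p) = 1 \<and> x = 0 \<and> cres P (pick (p, u)) = 3 + reg (P p) \<and> ctgt P (pick (p, u)) = jmp (P p)"
      then have "conf (Suc i) = (j, R(r := Suc (R r)))" using ins by (simp add: cs cstep_def)
      with h ins R show ?thesis unfolding adv by auto
    next
      assume h: "1 < opc (P p) \<and> x = 3 + reg (P p) \<and> cres P (pick (p, u)) = 2 \<and> ctgt P (pick (p, u)) = jmp (P p)"
      then have "R r > 0" using R[of r] ins by simp
      with h have "conf (Suc i) = (j, R(r := R r - 1))" using ins by (simp add: cs cstep_def)
      with h ins R show ?thesis unfolding adv by auto
    next
      assume h: "1 < opc (P p) \<and> x = 0 \<and> 3 + reg (P p) \<notin> set u \<and> cres P (pick (p, u)) = 2 \<and>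
        ctgt P (pick (p, u)) = jmp0 (P p)"
      then have "R r = 0" using ins by (simp add: R_def count_list_0_iff flip: i(2))
      with h have "conf (Suc i) = (j0, R)" using ins by (simp add: cs cstep_def)
      with h ins R show ?thesis unfolding adv by auto
    qed
    then show ?thesis by blast
  qed
  with 1 2 show ?thesis by (simp add: simulates_def)
qed

text \<open>Values chosen to drop with each instruction: pool to register costs 1, register to spent
  1, pool to spent 2.\<close>

definition weight :: "nat list \<Rightarrow> nat" where
  "weight u = sum_list (map (\<lambda>t. if t = 0 then 2 else if t < 3 then 0 else 1) u)"

text \<open>Lexicographic descent: a phase end kills a live item, and an instruction keeps their
  number but lowers \<open>weight\<close>.\<close>

lemma epoch_ends:
  assumes "simulates s" "\<not> halts"
  shows "\<exists>j. pick ((advance ^^ j) s) = 0"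
  using assms(1)
proof (induction "snd s" arbitrary: s rule: wf_induct_rule[OF wf_measures[of "[\<lambda>u. size (alive u), weight]"]])
  case (1 s)
  obtain p u where s: "s = (p, u)" by force
  from 1(2) obtain i where i: "fst (conf i) = p" and u: "u \<noteq> []" by (auto simp: simulates_def s)
  have op: "opc (P p) \<noteq> 0" using assms(2) i by (auto simp: halts_def)
  show ?case
  proof (cases "pick s = 0")
    case True
    then show ?thesis by (intro exI[of _ 0]) simp
  next
    case False
    have "(snd (advance s), snd s) \<in> measures [\<lambda>u. size (alive u), weight]"
    proof (cases "pick s = 1")
      case True
      have "\<exists>t\<in>set u. csel P 1 t" using pick_ok(2)[OF u op] True by (simp add: s)
      note ph = alive_imgs_phase_end[OF this]
      from arg_cong[OF ph(1), of size] have "size (alive (imgs 1 u)) = size (alive u) - 1" by simp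
      then show ?thesis using ph(2) True by (simp add: advance_def s)
    next
      case n1: False
      with False have "2 \<le> pick (p, u)" by (simp add: s)
      from instr_effect[OF u op this] obtain v x z where
        e: "u = v @ x # z" "imgs (pick (p, u)) u = v @ cres P (pick (p, u)) # z"
        "opc (P p) = 1 \<and> x = 0 \<and> cres P (pick (p, u)) = 3 + reg (P p) \<and> ctgt P (pick (p, u)) = jmp (P p) \<or>
         1 < opc (P p) \<and> x = 3 + reg (P p) \<and> cres P (pick (p, u)) = 2 \<and> ctgt P (pick (p, u)) = jmp (P p) \<or>
         1 < opc (P p) \<and> x = 0 \<and> 3 + reg (P p) \<notin> set u \<and> cres P (pick (p, u)) = 2 \<and> ctgt P (pick (p, u)) = jmp0 (P p)"
        by blast
      have "snd (advance s) = v @ cres P (pick (p, u)) # z" using False e(2) by (simp add: advance_def s)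
      moreover have "size (alive (v @ cres P (pick (p, u)) # z)) = size (alive u)"
        using e(3) by (auto simp: e(1) alive_def)
      moreover have "weight (v @ cres P (pick (p, u)) # z) < weight u"
        using e(3) unfolding e(1) weight_def by auto
      ultimately show ?thesis by (simp add: s)
    qed
    from 1(1)[OF this simulates_advance[OF 1(2) assms(2)]] obtain j
      where "pick ((advance ^^ j) (advance s)) = 0" by blast
    then show ?thesis by (intro exI[of _ "Suc j"]) (simp add: funpow_swap1)
  qed
qed

lemma not_halts_accepts:
  assumes "\<not> halts"
  shows "\<exists>w. timed_word aut w \<and> non_zeno w \<and> accepts aut w"
proof -
  \<comment> \<open>With a single dead item \<open>pick\<close> yields 0, the control letter with
    which every accepted word starts.\<close>
  define st where "st k = (advance ^^ k) (0, [1])" for k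
  have st_Suc: "st (Suc k) = advance (st k)" for k by (simp add: st_def)
  have sim: "simulates (st k)" for k
  proof (induction k)
    case 0
    have "fst (conf 0) = 0 \<and> (\<forall>r. count_list [1] (3 + r) = snd (conf 0) r)" by (simp add: conf_def)
    then show ?case by (auto simp: st_def simulates_def)
  qed (use simulates_advance assms in \<open>simp add: st_Suc\<close>)
  have op: "opc (P (fst (st k))) \<noteq> 0" and ne: "snd (st k) \<noteq> []" for k
    using sim[of k] assms by (auto simp: simulates_def halts_def) metis
  have ok: "pick (st k) < Suc (Suc (2 * N))" "\<exists>t\<in>set (snd (st k)). csel P (pick (st k)) t"
    "\<forall>t\<in>set (snd (st k)). \<not> cforb P (pick (st k)) t" for k
    using pick_ok[OF ne[of k] op[of k]] by simp_all
  interpret perfect_run "m + 3" "Suc (Suc (2 * N))" "csel P" "cforb P" "cres P" cdft "cnxt P"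
    "\<lambda>k. pick (st k)" "\<lambda>k. snd (st k)"
  proof unfold_locales
    show "pick (st 0) = 0" by (simp add: st_def pick_def)
    fix k
    show "\<exists>j>k. pick (st j) = 0"
    proof -
      from epoch_ends[OF sim assms] obtain j where j: "pick ((advance ^^ j) (st (Suc k))) = 0" by blast
      have "(advance ^^ j) (st (Suc k)) = st (j + Suc k)" unfolding st_def by (simp only: funpow_add o_apply)
      with j show ?thesis by (intro exI[of _ "j + Suc k"]) simp
    qed
    show "pick (st k) < Suc (Suc (2 * N))" "\<exists>t\<in>set (snd (st k)). csel P (pick (st k)) t" using ok by blast+
    show "cnxt P (pick (st k)) (pick (st (Suc k)))"
      unfolding cnxt_def st_Suc by (cases "advance (st k)") (auto simp: advance_def pick_def)
    show "set (snd (st k)) \<subseteq> {..<m + 3}" using sim[of k] by (simp add: simulates_def)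
    show "\<not> cforb P (pick (st k)) t" if "t \<in> set (snd (st k))" for t using ok(3) that by blast
    show "snd (st (Suc k)) = (if pick (st k) = 0 then [0] else []) @ imgs (pick (st k)) (snd (st k))"
      by (simp add: st_Suc advance_def)
  qed (simp add: st_def)
  show ?thesis using word_timed word_non_zeno word_accepted by blast
qed

lemma accepts_iff_not_halts:
  "(\<exists>w. timed_word aut w \<and> non_zeno w \<and> accepts aut w) \<longleftrightarrow> \<not> halts"
  "(\<exists>w. timed_word aut w \<and> accepts aut w) \<longleftrightarrow> \<not> halts"
  using accepts_faulty_run faulty_run_not_halts not_halts_accepts by blast+

end

section \<open>Diagonalisation\<close>

text \<open>Defined on all numbers: as \<open>prod_decode 0 = (0, 0)\<close>, reading past the end
  of a list yields 0, which decodes to a halting instruction.\<close>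

fun tail_code :: "nat \<Rightarrow> nat \<Rightarrow> nat" where
  "tail_code 0 e = e"
| "tail_code (Suc p) e = snd (prod_decode (tail_code p e - 1))"

definition decode_instr :: "nat \<Rightarrow> instr" where
  "decode_instr v = (fst (prod_decode v), fst (prod_decode (snd (prod_decode v))),
     fst (prod_decode (snd (prod_decode (snd (prod_decode v))))),
     snd (prod_decode (snd (prod_decode (snd (prod_decode v))))))"

definition encode_instr :: "instr \<Rightarrow> nat" where
  "encode_instr c = prod_encode (opc c, prod_encode (reg c, prod_encode (jmp c, jmp0 c)))"

definition fetch :: "nat \<Rightarrow> nat \<Rightarrow> instr" where
  "fetch e p = decode_instr (fst (prod_decode (tail_code p e - 1)))"

text \<open>The first \<open>e\<close> increments load the code \<open>e\<close> into register 0.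
  The program coded by \<open>e\<close> follows, relocated by \<open>e\<close> together with its
  jump targets.\<close>

definition load :: "nat \<Rightarrow> nat \<Rightarrow> instr" where
  "load e p = (if p < e then (1, 0, Suc p, 0)
     else (opc (fetch e (p - e)), reg (fetch e (p - e)),
       e + jmp (fetch e (p - e)), e + jmp0 (fetch e (p - e))))"

lemma prod_decode_le: "fst (prod_decode n) \<le> n" "snd (prod_decode n) \<le> n"
proof -
  obtain a b where ab: "prod_decode n = (a, b)" by force
  then have "prod_encode (a, b) = n" by (metis prod_decode_inverse)
  with ab show "fst (prod_decode n) \<le> n" "snd (prod_decode n) \<le> n"
    using le_prod_encode_1[of a b] le_prod_encode_2[of b a] by auto
qed

text \<open>Every tail has a smaller code, so the program coded by \<open>e\<close> has at most
  \<open>e\<close> instructions; with the loader this gives the address bound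
  \<open>2 * e\<close>.\<close>

lemma tail_code_le: "tail_code p e \<le> e - p"
proof (induction p)
  case (Suc p)
  with prod_decode_le(2)[of "tail_code p e - 1"] show ?case by simp
qed simp

lemma decode_instr_0: "opc (decode_instr 0) = 0"
  using prod_decode_le[of 0] by (simp add: decode_instr_def)

lemma fetch_beyond: "tail_code p e = 0 \<Longrightarrow> opc (fetch e p) = 0"
  using prod_decode_le[of 0] by (simp add: fetch_def decode_instr_0)

lemma reg_fetch_le: "reg (fetch e p) \<le> e"
proof -
  let ?t = "tail_code p e - 1"
  have "reg (fetch e p) \<le> snd (prod_decode (fst (prod_decode ?t)))"
    by (simp add: fetch_def decode_instr_def prod_decode_le)
  also have "\<dots> \<le> fst (prod_decode ?t)" by (rule prod_decode_le)
  also have "\<dots> \<le> ?t" by (rule prod_decode_le)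
  also have "\<dots> \<le> e" using tail_code_le[of p e] by simp
  finally show ?thesis .
qed

interpretation M: machine "load e" "Suc e" "2 * e" for e
proof
  fix p
  show "reg (load e p) < Suc e" using reg_fetch_le[of e "p - e"] by (simp add: load_def)
  assume op: "opc (load e p) \<noteq> 0"
  show "p < 2 * e"
  proof (rule ccontr)
    assume "\<not> p < 2 * e"
    then have "tail_code (p - e) e = 0" "\<not> p < e" using tail_code_le[of "p - e" e] by simp_all
    with op fetch_beyond show False by (simp add: load_def)
  qed
qed

lemma tail_code_list: "p \<le> length xs \<Longrightarrow> tail_code p (list_encode xs) = list_encode (drop p xs)"
proof (induction p)
  case (Suc p)
  then have "drop p xs = xs ! p # drop (Suc p) xs" by (simp add: Cons_nth_drop_Suc)
  with Suc show ?case by simp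
qed simp

lemma tail_code_zero: "tail_code p 0 = 0"
  using tail_code_le[of p 0] by simp

lemma tail_code_add: "tail_code (p + q) e = tail_code p (tail_code q e)"
  by (induction p) auto

lemma fetch_code:
  "fetch (list_encode (map encode_instr cs)) p = (if p < length cs then cs ! p else decode_instr 0)"
proof (cases "p < length cs")
  case True
  then have "drop p (map encode_instr cs) = encode_instr (cs ! p) # drop (Suc p) (map encode_instr cs)"
    by (metis Cons_nth_drop_Suc length_map nth_map)
  then show ?thesis using True tail_code_list[of p "map encode_instr cs"]
    by (simp add: fetch_def decode_instr_def encode_instr_def)
next
  case False
  have "tail_code ((p - length cs) + length cs) (list_encode (map encode_instr cs)) = 0"
    unfolding tail_code_add using tail_code_list[of "length cs" "map encode_instr cs"] by (simp add: tail_code_zero)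
  then show ?thesis using False prod_decode_le[of 0] by (simp add: fetch_def)
qed

lemma load_steps:
  "(cstep (load e) ^^ n) (e + p, R) =
    (e + fst ((cstep (fetch e) ^^ n) (p, R)), snd ((cstep (fetch e) ^^ n) (p, R)))"
proof (induction n)
  case (Suc n)
  then show ?case
    by (cases "(cstep (fetch e) ^^ n) (p, R)") (simp add: cstep_def load_def split: prod.splits)
qed simp

lemma load_prefix: "i \<le> e \<Longrightarrow> M.conf e i = (i, (\<lambda>_. 0)(0 := i))"
proof (induction i)
  case (Suc i)
  moreover from Suc.prems have "load e i = (1, 0, Suc i, 0)" by (simp add: load_def)
  ultimately show ?case by (auto simp: M.conf_Suc cstep_def[of "load e" "(i, _)"])
qed (auto simp: M.conf_def)

lemma load_halts_iff:
  "M.halts e \<longleftrightarrow> (\<exists>n. opc (fetch e (fst ((cstep (fetch e) ^^ n) (0, (\<lambda>_. 0)(0 := e))))) = 0)"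
proof -
  have c: "M.conf e (n + e) = (e + fst ((cstep (fetch e) ^^ n) (0, (\<lambda>_. 0)(0 := e))),
     snd ((cstep (fetch e) ^^ n) (0, (\<lambda>_. 0)(0 := e))))" for n
    using load_prefix[of e e] load_steps[of n e 0] unfolding M.conf_def funpow_add o_apply by simp
  have early: "opc (load e (fst (M.conf e i))) \<noteq> 0" if "i < e" for i
    using load_prefix[of i e] that by (simp add: load_def)
  have late: "opc (load e (fst (M.conf e (n + e)))) =
     opc (fetch e (fst ((cstep (fetch e) ^^ n) (0, (\<lambda>_. 0)(0 := e)))))" for n
    by (simp add: c load_def)
  show ?thesis
  proof
    assume "M.halts e"
    then obtain i where i: "opc (load e (fst (M.conf e i))) = 0" unfolding M.halts_def by blast
    with early have "e \<le> i" by (meson not_less)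
    with i late[of "i - e"] show "\<exists>n. opc (fetch e (fst ((cstep (fetch e) ^^ n) (0, (\<lambda>_. 0)(0 := e))))) = 0"
      by auto
  next
    assume "\<exists>n. opc (fetch e (fst ((cstep (fetch e) ^^ n) (0, (\<lambda>_. 0)(0 := e))))) = 0"
    then show "M.halts e" unfolding M.halts_def using late by metis
  qed
qed

lemma cstep_halted: "opc (P (fst c)) = 0 \<Longrightarrow> cstep P c = c"
  by (cases c) (auto simp: cstep_def split: prod.splits)

lemma halted_stays:
  "opc (P (fst ((cstep P ^^ i) c))) = 0 \<Longrightarrow> (cstep P ^^ (j + i)) c = (cstep P ^^ i) c"
  by (induction j) (auto simp: cstep_halted)

definition diag_code :: "recf \<Rightarrow> nat" where
  "diag_code f = list_encode (map encode_instr (compile f [0] 1 2 0 @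
     [(2, 1, Suc (length (compile f [0] 1 2 0)), length (compile f [0] 1 2 0))]))"

text \<open>The appended instruction loops forever exactly if the computed value is 0.\<close>
lemma diag_code_halts:
  assumes "eval_rf f [diag_code f] y"
  shows "M.halts (diag_code f) \<longleftrightarrow> y \<noteq> 0"
proof -
  define c where "c = compile f [0] 1 2 0"
  define e where "e = diag_code f"
  define Q where "Q = fetch e"
  have e: "e = list_encode (map encode_instr (c @ [(2, 1, Suc (length c), length c)]))"
    by (simp add: e_def diag_code_def c_def)
  have Q: "Q p = (if p < length c then c ! p else if p = length c then (2, 1, Suc (length c), length c)
      else decode_instr 0)" for p
    unfolding Q_def e fetch_code by (auto simp: nth_append)
  let ?s = "(0, (\<lambda>_. 0)(0 := e)) :: nat \<times> (nat \<Rightarrow> nat)"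
  have "runs_to Q 0 ((\<lambda>_. 0)(0 := e)) (0 + length (compile f [0] 1 2 0)) 2 1 y"
    by (rule compile_correct[OF assms]) (auto simp: has_code_def Q c_def e_def)
  then obtain R n where R: "(cstep Q ^^ n) ?s = (length c, R)" "R 1 = y"
    by (auto simp: runs_to_def steps_def c_def)
  have "(\<exists>n. opc (Q (fst ((cstep Q ^^ n) ?s))) = 0) \<longleftrightarrow> y \<noteq> 0"
  proof (cases "y = 0")
    case True
    have "cstep Q (length c, R) = (length c, R)" using True R(2) by (simp add: cstep_def Q)
    then have fixp: "(cstep Q ^^ (j + n)) ?s = (length c, R)" for j by (induction j) (auto simp: R(1))
    have "opc (Q (fst ((cstep Q ^^ i) ?s))) \<noteq> 0" for i
    proof
      assume z: "opc (Q (fst ((cstep Q ^^ i) ?s))) = 0"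
      from halted_stays[of Q i ?s n, OF z] fixp[of i] have "(cstep Q ^^ i) ?s = (length c, R)" by (simp add: add.commute)
      with z show False by (simp add: Q)
    qed
    with True show ?thesis by simp
  next
    case False
    have "(cstep Q ^^ Suc n) ?s = (Suc (length c), R(1 := R 1 - 1))"
      using False R by (simp add: cstep_def Q)
    then have "opc (Q (fst ((cstep Q ^^ Suc n) ?s))) = 0" by (simp add: Q decode_instr_0)
    with False show ?thesis by blast
  qed
  then show ?thesis unfolding load_halts_iff e_def[symmetric] Q_def .
qed

section \<open>Computability of the automaton from the program code\<close>

lemma computable_tail_code: "computable n f \<Longrightarrow> computable n g \<Longrightarrow> computable n (\<lambda>xs. tail_code (f xs) (g xs))"
  by (rule computable_app2[of tail_code], rule computable_rec[of "\<lambda>y. y" "\<lambda>m r y. snd (prod_decode (r - 1))"])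
    (auto intro!: computable_nth computable_snd computable_diff computable_const)

lemma computable_fetch:
  assumes "computable n f" "computable n g"
  shows "computable n (\<lambda>xs. opc (fetch (f xs) (g xs)))" "computable n (\<lambda>xs. reg (fetch (f xs) (g xs)))"
    "computable n (\<lambda>xs. jmp (fetch (f xs) (g xs)))" "computable n (\<lambda>xs. jmp0 (fetch (f xs) (g xs)))"
  unfolding fetch_def decode_instr_def fst_conv snd_conv
  by (intro computable_fst computable_snd computable_tail_code computable_diff computable_const assms)+

lemma computable_load:
  assumes "computable n f" "computable n g"
  shows "computable n (\<lambda>xs. opc (load (f xs) (g xs)))" "computable n (\<lambda>xs. reg (load (f xs) (g xs)))"
    "computable n (\<lambda>xs. jmp (load (f xs) (g xs)))" "computable n (\<lambda>xs. jmp0 (load (f xs) (g xs)))"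
  unfolding load_def if_distrib[of fst] if_distrib[of snd] fst_conv snd_conv
  by (intro computable_if computable_pred_less computable_fetch computable_diff computable_add computable_Suc computable_const assms)+

lemma computable_enc_if:
  "computable_pred n c \<Longrightarrow> computable n (\<lambda>xs. enc_bf (f xs)) \<Longrightarrow> computable n (\<lambda>xs. enc_bf (g xs)) \<Longrightarrow>
   computable n (\<lambda>xs. enc_bf (if c xs then f xs else g xs))"
  unfolding if_distrib[of enc_bf] by (rule computable_if)

lemma computable_enc_atom: "computable n f \<Longrightarrow> computable n (\<lambda>xs. enc_bf (BAtom (f xs) c))"
  unfolding enc_bf.simps by (intro computable_prod_encode computable_const)

lemma computable_enc_and:
  "computable n (\<lambda>xs. enc_bf (f xs)) \<Longrightarrow> computable n (\<lambda>xs. enc_bf (g xs)) \<Longrightarrow> computable n (\<lambda>xs. enc_bf (BAnd (f xs) (g xs)))"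
  unfolding enc_bf.simps by (intro computable_prod_encode computable_const)

lemma computable_enc_cc: "computable_pred n c \<Longrightarrow> computable n (\<lambda>xs. enc_cc (if c xs then \<theta> else \<theta>'))"
  unfolding if_distrib[of enc_cc] by (intro computable_if computable_const)

lemmas computable_intros = computable_enc_if computable_enc_atom computable_enc_and computable_enc_cc computable_if computable_pred_if computable_pred_conj computable_pred_disj computable_pred_not computable_pred_eq computable_pred_less
  computable_load computable_prod_encode computable_Suc computable_add computable_mult computable_diff computable_div computable_mod

lemma computable_trans:
  assumes "computable n e" "computable n q" "computable n a" "computable_pred n b"
  shows "computable n (\<lambda>xs. enc_bf (M.trans (e xs) (q xs) (a xs) (b xs)))"
  unfolding M.trans_def M.img_def M.par_def M.main_def M.wait_def M.start_def
    csel_def cforb_def cres_def cdft_def cnxt_def ctgt_def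
  by (intro computable_intros assms computable_const computable_pred_const)

lemma computable_enc_ata: "computable (Suc 0) (\<lambda>xs. enc_ata (M.aut (xs ! 0)))"
proof -
  have "computable 2 (\<lambda>xs. enc_trans (M.entry (xs ! 1) (xs ! 0)))"
    unfolding enc_trans_def M.entry_def M.nlet_def split list_encode.simps
    by (intro computable_trans computable_intros computable_nth computable_const) simp_all
  then have d: "computable (Suc 0) (\<lambda>xs. list_encode (map (\<lambda>i. enc_trans (M.entry (xs ! 0) i))
      [0..<M.nst (xs ! 0) * (2 * M.nlet (xs ! 0))]))"
    by (rule computable_list_encode_map[rotated]) (unfold M.nlet_def M.nst_def, intro computable_intros computable_nth computable_const, simp_all)
  have "computable 2 (\<lambda>xs. if xs ! 0 = M.wait (xs ! 1) then 1 else 2)"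
    unfolding M.wait_def by (intro computable_intros computable_nth computable_const) simp_all
  then have om: "computable (Suc 0) (\<lambda>xs. list_encode (map (\<lambda>q. if q = M.wait (xs ! 0) then 1 else 2) [0..<M.nst (xs ! 0)]))"
    by (rule computable_list_encode_map[rotated]) (unfold M.nst_def, intro computable_intros computable_nth computable_const, simp_all)
  have "enc_ata (M.aut e) = list_encode [M.nst e, M.nlet e, M.start e,
      list_encode (map (\<lambda>i. enc_trans (M.entry e i)) [0..<M.nst e * (2 * M.nlet e)]),
      list_encode (map (\<lambda>q. if q = M.wait e then 1 else 2) [0..<M.nst e])]" for e
    unfolding enc_ata_def M.aut_def ata.select_convs map_map o_def ..
  then show ?thesis
    unfolding list_encode.simps
    by (simp only:) (unfold M.nst_def M.nlet_def M.start_def, intro computable_intros d[unfolded M.nst_def M.nlet_def] om[unfolded M.nst_def] computable_nth computable_const, simp_all)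
qed

text \<open>Stated for any property that agrees with non-halting on the automata
  \<open>M.aut e\<close>, so as to cover acceptance with and without the non-Zeno condition.\<close>

lemma undecidable_acceptance:
  assumes "\<And>e. \<Phi> (M.aut e) \<longleftrightarrow> \<not> M.halts e"
  shows "\<not> decidable_on enc_ata input_class \<Phi>"
proof
  assume "decidable_on enc_ata input_class \<Phi>"
  then obtain r where r: "\<And>A. input_class A \<Longrightarrow> eval_rf r [enc_ata A] (if \<Phi> A then 1 else 0)"
    unfolding decidable_on_def by blast
  obtain h where "\<And>xs. length xs = Suc 0 \<Longrightarrow> eval_rf h xs (enc_ata (M.aut (xs ! 0)))"
    using computable_enc_ata unfolding computable_def by blast
  then have h: "eval_rf h [e] (enc_ata (M.aut e))" for e by (metis length_Cons list.size(3) nth_Cons_0)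
  define f where "f = Cn r [h]"
  have ev: "eval_rf f [e] (if \<Phi> (M.aut e) then 1 else 0)" for e
    unfolding f_def by (rule ev_Cn[where ys = "[enc_ata (M.aut e)]"]) (use h r M.aut_input_class in auto)
  \<comment> \<open>For \<open>e = diag_code f\<close>, \<open>M.halts e\<close> holds iff
    \<open>f\<close> yields 1 on \<open>e\<close>, iff \<open>\<Phi> (M.aut e)\<close>, iff
    \<open>M.halts e\<close> fails.\<close>
  from diag_code_halts[OF ev] assms[of "diag_code f"] show False by (auto split: if_splits)
qed

theorem theorem5p2:
  shows "\<not> decidable_on enc_ata input_class
            (\<lambda>A. \<exists>w. timed_word A w \<and> non_zeno w \<and> accepts A w)
       \<and> \<not> decidable_on enc_ata input_class
            (\<lambda>A. \<exists>w. timed_word A w \<and> accepts A w)"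
  by (intro conjI undecidable_acceptance M.accepts_iff_not_halts)

end
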